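(* Let $S_\tau=\{(W,\mathcal W),(X,\mathcal X),u,P,\{\Gamma_x\}_{x\in X}\}$ be a polynomial RSCC satisfying the standing assumptions, and assume that $\Gamma_x$ is a compact subset of $\mathrm{Poly}_+$ for each $x\in X$. Let $\pi\in\mathsf{Stat}$ satisfy $\operatorname{supp}\pi=W$, and assume that for each $z\in\widehat{\mathbb C}$ the map $W\ni w\mapsto T_{\infty,\tilde\tau_w}(z)$ is continuous. For $B\in\mathcal W$ define the $\pi$-essential filled-in set $$K_B^\pi(S_\tau):=\{z\in\widehat{\mathbb C}:\pi(\{w\in B: z\in K_w(S_\tau)\})=\pi(B)\}.$$ Suppose there exist $B_1,B_2\in\mathcal W$ with $\pi(B_1)>0$, $\pi(B_2)>0$, $K_{B_1}^\pi(S_\tau)\ne\emptyset$, $K_{B_2}^\pi(S_\tau)\neq\emptyset$ and $K_{B_1}^\pi(S_\tau)\cap K_{B_2}^\pi(S_\tau)=\emptyset$. Then $T_{\infty,\tau,\pi}(z)>0$ for every $z\in\widehat{\mathbb C}$, and there exists $z_0\in\widehat{\mathbb C}$ with $T_{\infty,\tau,\pi}(z_0)<1$.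
   Context: **RSCC.** A random system with complete connections (RSCC) is a quadruple $\{(W,\mathcal W),(X,\mathcal X),u,P\}$ where $(W,\mathcal W)$ (state space) and $(X,\mathcal X)$ (index space) are measurable spaces, $u\colon W\times X\to W$ (update map) is measurable, and $P$ is a transition probability function from $(W,\mathcal W)$ to $(X,\mathcal X)$. Write $wx:=u(w,x)$ and, inductively, $wx^{(n)}:=u(wx^{(n-1)},x_n)$ for $x^{(n)}=(x_1,\dots,x_n)\in X^n$, where $x^{(n-1)}=(x_1,\dots,x_{n-1})$. The induced Markov kernel on $W$ is $Q(w,A):=\int_X\mathbf 1_A(u(w,x))\,P(w,dx)$, with operator $(\mathbf Uf)(w):=\int_W f(w')\,Q(w,dw')$. **Standing assumptions.** $X$ is finite and discrete, $\mathcal X$ is its power set; $W$ is a compact metric space and $\mathcal W=\mathcal B(W)$ is its Borel $\sigma$-algebra; for each $x\in X$ the map $v\mapsto P(v,\{x\})$ is continuous on $W$; the kernel $Q$ is continuous, i.e. $\mathbf U$ maps $C(W)$ into $C(W)$. **Polynomial RSCC.** $\widehat{\mathbb C}$ is the Riemann sphere with spherical metric $d_{\widehat{\mathbb C}}$. $\mathrm{Poly}$ is the set of non-constant polynomial maps $\widehat{\mathbb C}\to\widehat{\mathbb C}$ with metric $\sup_z d_{\widehat{\mathbb C}}(f(z),g(z))$, and $\mathrm{Poly}_+=\{h\in\mathrm{Poly}:\deg h\ge2\}$. For each $x\in X$ a Borel probability measure $\tau_x$ on $\mathrm{Poly}$ is fixed and $\Gamma_x:=\operatorname{supp}\tau_x\subset\mathrm{Poly}$.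 The resulting system $S_\tau=\{(W,\mathcal W),(X,\mathcal X),u,P,\{\Gamma_x\}_{x\in X}\}$ is called a polynomial RSCC. **Admissible words and paths.** For $w\in W$, $\mathbf P_w$ is the unique probability measure on $X^{\mathbb N}$ with $\mathbf P_w([x_1,\dots,x_n])=P(w,\{x_1\})P(wx_1,\{x_2\})\cdots P(wx^{(n-1)},\{x_n\})$ on cylinders. Let $X_{w,n}:=\{x^{(n)}\in X^n:\mathbf P_w([x^{(n)}])>0\}$. Let $$H_w(S_\tau):=\{\gamma_n\circ\cdots\circ\gamma_1: n\in\mathbb N,\ x^{(n)}\in X_{w,n},\ \gamma_j\in\Gamma_{x_j}\ (1\le j\le n)\},$$ $$\Xi_w(S_\tau):=\{(\gamma_n,x_n)_{n\in\mathbb N}\in(\mathrm{Poly}\times X)^{\mathbb N}:(x_n)\in\operatorname{supp}\mathbf P_w,\ \gamma_n\in\Gamma_{x_n}\ \forall n\}.$$ $\tilde\tau_w$ is the probability measure on $\Xi_w(S_\tau)$ (with the $\sigma$-algebra generated by cylinders) determined by: the set of all $(\gamma_k,x'_k)_k\in\Xi_w(S_\tau)$ with $x'_k=x_k$ and $\gamma_k\in A_k$ for $1\le k\le n$ has measure $\mathbf P_w([x_1,\dots,x_n])\prod_{k=1}^n\tau_{x_k}(A_k)$, for $x^{(n)}\in X_{w,n}$ and Borel $A_k\subset\Gamma_{x_k}$. Write $\gamma_{n,1}:=\gamma_n\circ\cdots\circ\gamma_1$. **Escaping probability.** $T_{\infty,\tilde\tau_w}(z):=\tilde\tau_w(\{(\gamma_n,x_n)_n\in\Xi_w(S_\tau):\gamma_{n,1}(z)\to\infty\text{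 in }\widehat{\mathbb C}\text{ as }n\to\infty\})$. **Smallest filled-in Julia set at $w$.** $K_w(S_\tau):=\{z\in\widehat{\mathbb C}:\{\gamma(z):\gamma\in H_w(S_\tau)\}\text{ is bounded in }\mathbb C\}$ (in particular this set of images must be contained in $\mathbb C$). **Stationary distributions.** $\mathsf{Stat}$ is the set of Borel probability measures $\pi$ on $W$ with $\pi(A)=\int_W Q(w,A)\,\pi(dw)$ for all $A\in\mathcal W$. For $\pi\in\mathsf{Stat}$ the stationary-averaged escaping probability is $T_{\infty,\tau,\pi}(z):=\int_W T_{\infty,\tilde\tau_w}(z)\,\pi(dw)$, $z\in\widehat{\mathbb C}$. *)

theory Defs
  imports "HOL-Probability.Probability" "HOL-Computational_Algebra.Polynomial"
begin

section \<open>The Riemann sphere\<close>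

datatype rsphere = Fin complex | Infty

text \<open>Stereographic projection onto the unit sphere of the Euclidean space
  \<open>complex \<times> real\<close>.\<close>

fun stereo :: "rsphere \<Rightarrow> complex \<times> real" where
  "stereo (Fin z) = ((2 / (1 + (cmod z)\<^sup>2)) *\<^sub>R z, ((cmod z)\<^sup>2 - 1) / ((cmod z)\<^sup>2 + 1))"
| "stereo Infty = (0, 1)"

lemma norm_stereo: "norm (stereo p) = 1"
proof (cases p)
  case (Fin z)
  define r where "r = (cmod z)\<^sup>2"
  have r: "r \<ge> 0" by (simp add: r_def)
  have n1: "(norm ((2 / (1 + (cmod z)\<^sup>2)) *\<^sub>R z))\<^sup>2 = 4 * r / (1 + r)\<^sup>2"
    by (simp add: power_mult_distrib power_divide r_def)
  have "(norm ((2 / (1 + (cmod z)\<^sup>2)) *\<^sub>R z))\<^sup>2 + (norm ((r - 1) / (r + 1)))\<^sup>2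
      = 4 * r / (1 + r)\<^sup>2 + (r - 1)\<^sup>2 / (r + 1)\<^sup>2"
    unfolding n1 by (simp add: power_divide)
  also have "\<dots> = (4 * r + (r - 1)\<^sup>2) / (1 + r)\<^sup>2"
    by (simp add: add_divide_distrib add.commute)
  also have "4 * r + (r - 1)\<^sup>2 = (1 + r)\<^sup>2" by (simp add: power2_eq_square algebra_simps)
  also have "(1 + r)\<^sup>2 / (1 + r)\<^sup>2 = 1" using r by simp
  finally show ?thesis using Fin by (simp add: norm_Pair r_def)
qed (simp add: norm_Pair)

lemma inj_stereo: "stereo p = stereo q \<Longrightarrow> p = q"
proof -
  have last_neq: "(s - 1) / (s + 1) \<noteq> 1" if "s \<ge> 0" for s :: real
    using that by (simp add: divide_eq_eq)
  have last_inj: "s = t" if "s \<ge> 0" "t \<ge> 0" "(s - 1) / (s + 1) = (t - 1) / (t + 1)" for s t :: real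
  proof -
    have "(s - 1) * (t + 1) = (t - 1) * (s + 1)" using that by (simp add: frac_eq_eq)
    then show ?thesis by (simp add: algebra_simps)
  qed
  assume eq: "stereo p = stereo q"
  show "p = q"
  proof (cases p; cases q)
    fix z w assume p: "p = Fin z" and q: "q = Fin w"
    from arg_cong[OF eq, of snd]
    have "((cmod z)\<^sup>2 - 1) / ((cmod z)\<^sup>2 + 1) = ((cmod w)\<^sup>2 - 1) / ((cmod w)\<^sup>2 + 1)"
      unfolding p q stereo.simps snd_conv .
    from last_inj[OF _ _ this] have same: "(cmod z)\<^sup>2 = (cmod w)\<^sup>2" by simp
    have nz: "2 / (1 + (cmod w)\<^sup>2) \<noteq> 0"
      using zero_le_power2[of "cmod w"] by (simp add: add_nonneg_eq_0_iff)
    from arg_cong[OF eq, of fst]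
    have "(2 / (1 + (cmod w)\<^sup>2)) *\<^sub>R z = (2 / (1 + (cmod w)\<^sup>2)) *\<^sub>R w"
      unfolding p q stereo.simps fst_conv same .
    then have "z = w" using nz by (simp only: scaleR_cancel_left) simp
    then show "p = q" using p q by simp
  next
    fix z assume "p = Fin z" "q = Infty"
    then show "p = q" using eq last_neq[of "(cmod z)\<^sup>2"] by simp
  next
    fix z assume "p = Infty" "q = Fin z"
    with arg_cong[OF eq, of snd] have "((cmod z)\<^sup>2 - 1) / ((cmod z)\<^sup>2 + 1) = 1" by (simp only: stereo.simps snd_conv)
    then show "p = q" using last_neq[of "(cmod z)\<^sup>2"] by simp
  qed simp
qed

lemma arccos_inner_triangle:
  fixes a b c :: "'a::real_inner"
  assumes "norm a = 1" "norm b = 1" "norm c = 1"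
  shows "arccos (a \<bullet> c) \<le> arccos (a \<bullet> b) + arccos (b \<bullet> c)"
proof -
  have bd: "\<bar>x \<bullet> y\<bar> \<le> 1" if "norm x = 1" "norm y = 1" for x y :: 'a
    using Cauchy_Schwarz_ineq2[of x y] that by simp
  have sq: "x \<bullet> x = 1" if "norm x = 1" for x :: 'a
    using that by (simp add: norm_eq_1)
  define s t where "s = a \<bullet> b" and "t = b \<bullet> c"
  define u v where "u = a - s *\<^sub>R b" and "v = c - t *\<^sub>R b"
  have st: "\<bar>s\<bar> \<le> 1" "\<bar>t\<bar> \<le> 1" using bd assms by (auto simp: s_def t_def)
  have uu: "u \<bullet> u = 1 - s\<^sup>2"
    using sq assms by (simp add: u_def s_def inner_diff inner_commute power2_eq_square algebra_simps)
  have vv: "v \<bullet> v = 1 - t\<^sup>2"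
    using sq assms by (simp add: v_def t_def inner_diff inner_commute power2_eq_square algebra_simps)
  have uv: "u \<bullet> v = a \<bullet> c - s * t"
    using sq assms by (simp add: u_def v_def s_def t_def inner_diff inner_commute algebra_simps)
  have "- (u \<bullet> v) \<le> norm u * norm v" using Cauchy_Schwarz_ineq2[of u v] by simp
  then have le: "s * t - sqrt (1 - s\<^sup>2) * sqrt (1 - t\<^sup>2) \<le> a \<bullet> c"
    using uu vv uv by (simp add: norm_eq_sqrt_inner)
  have cs: "cos (arccos s + arccos t) = s * t - sqrt (1 - s\<^sup>2) * sqrt (1 - t\<^sup>2)"
    using st by (simp add: cos_add sin_arccos_abs cos_arccos_abs)
  show ?thesis
  proof (cases "arccos s + arccos t \<le> pi")
    case True
    have nn: "0 \<le> arccos s + arccos t" using st by (simp add: arccos_lbound abs_le_iff)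
    have "arccos (a \<bullet> c) \<le> arccos (cos (arccos s + arccos t))"
    proof (rule arccos_le_arccos)
      show "cos (arccos s + arccos t) \<le> a \<bullet> c" using le cs by simp
      show "a \<bullet> c \<le> 1" using bd[of a c] assms by (simp add: abs_le_iff)
    qed simp
    also have "\<dots> = arccos s + arccos t" using True nn by (simp add: arccos_cos)
    finally show ?thesis by (simp add: s_def t_def)
  next
    case False
    moreover have "arccos (a \<bullet> c) \<le> pi" using bd[of a c] assms by (intro arccos_ubound) (auto simp: abs_le_iff)
    ultimately show ?thesis by (simp add: s_def t_def)
  qed
qed

text \<open>The spherical metric is the geodesic distance on the unit sphere.\<close>

instantiation rsphere :: metric_space
begin

definition dist_rsphere :: "rsphere \<Rightarrow> rsphere \<Rightarrow> real" where
  "dist_rsphere p q = arccos (stereo p \<bullet> stereo q)"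

definition uniformity_rsphere :: "(rsphere \<times> rsphere) filter" where
  "uniformity_rsphere = (INF e\<in>{0<..}. principal {(x, y). dist x y < e})"

definition open_rsphere :: "rsphere set \<Rightarrow> bool" where
  "open_rsphere U \<longleftrightarrow> (\<forall>x\<in>U. eventually (\<lambda>(x', y). x' = x \<longrightarrow> y \<in> U) uniformity)"

instance
proof
  fix x y z :: rsphere
  show "(dist x y = 0) = (x = y)"
  proof
    assume d: "dist x y = 0"
    have "\<bar>stereo x \<bullet> stereo y\<bar> \<le> 1"
      using Cauchy_Schwarz_ineq2[of "stereo x" "stereo y"] by (simp add: norm_stereo)
    then have "stereo x \<bullet> stereo y = cos (dist x y)"
      by (simp add: dist_rsphere_def cos_arccos_abs)
    then have "stereo x \<bullet> stereo y = 1" by (simp add: d)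
    then have "(norm (stereo x - stereo y))\<^sup>2 = 0"
      unfolding power2_norm_eq_inner using norm_stereo[of x] norm_stereo[of y]
      by (simp add: inner_diff inner_commute norm_eq_1)
    then show "x = y" by (auto intro: inj_stereo)
  next
    assume "x = y"
    then show "dist x y = 0"
      using norm_stereo[of y] by (simp add: dist_rsphere_def norm_eq_1)
  qed
  show "dist x y \<le> dist x z + dist y z"
    unfolding dist_rsphere_def
    using arccos_inner_triangle[of "stereo x" "stereo z" "stereo y"]
    by (simp add: norm_stereo inner_commute)
qed (simp_all only: uniformity_rsphere_def open_rsphere_def)

end

lemma dist_rsphere_le_pi: "dist (p :: rsphere) q \<le> pi"
  unfolding dist_rsphere_def
  using Cauchy_Schwarz_ineq2[of "stereo p" "stereo q"]
  by (intro arccos_ubound) (auto simp: norm_stereo abs_le_iff)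

definition bounded_in_plane :: "rsphere set \<Rightarrow> bool" where
  "bounded_in_plane A \<longleftrightarrow> (\<exists>S. bounded S \<and> A \<subseteq> Fin ` S)"


section \<open>Spaces of polynomial maps\<close>

fun sphere_map :: "complex poly \<Rightarrow> rsphere \<Rightarrow> rsphere" where
  "sphere_map p (Fin z) = Fin (poly p z)"
| "sphere_map p Infty = Infty"

typedef poly_map = "{f. \<exists>p. degree p \<ge> 1 \<and> f = sphere_map p}"
  morphisms app Abs_poly_map
proof
  show "sphere_map [:0, 1:] \<in> {f. \<exists>p. degree p \<ge> 1 \<and> f = sphere_map p}"
    by (auto intro!: exI[of _ "[:0, 1:]"])
qed

instantiation poly_map :: metric_space
begin

definition dist_poly_map :: "poly_map \<Rightarrow> poly_map \<Rightarrow> real" where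
  "dist_poly_map f g = (SUP z. dist (app f z) (app g z))"

definition uniformity_poly_map :: "(poly_map \<times> poly_map) filter" where
  "uniformity_poly_map = (INF e\<in>{0<..}. principal {(x, y). dist x y < e})"

definition open_poly_map :: "poly_map set \<Rightarrow> bool" where
  "open_poly_map U \<longleftrightarrow> (\<forall>x\<in>U. eventually (\<lambda>(x', y). x' = x \<longrightarrow> y \<in> U) uniformity)"

instance
proof
  fix f g h :: poly_map
  have bdd: "bdd_above (range (\<lambda>z. dist (app f z) (app g z)))" for f g
    using dist_rsphere_le_pi by (auto intro!: bdd_aboveI2)
  have ub: "dist (app f z) (app g z) \<le> dist f g" for f g z
    unfolding dist_poly_map_def by (rule cSUP_upper[OF _ bdd]) simp
  show "(dist f g = 0) = (f = g)"
  proof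
    assume "dist f g = 0"
    then have "app f z = app g z" for z
      using ub[where f = f and g = g and z = z] by simp
    then show "f = g" by (metis app_inject ext)
  qed (simp add: dist_poly_map_def)
  show "dist f g \<le> dist f h + dist g h"
    unfolding dist_poly_map_def[of f g]
  proof (rule cSUP_least)
    fix z
    have "dist (app f z) (app g z) \<le> dist (app f z) (app h z) + dist (app g z) (app h z)"
      by (rule dist_triangle2)
    also have "\<dots> \<le> dist f h + dist g h" by (intro add_mono ub)
    finally show "dist (app f z) (app g z) \<le> dist f h + dist g h" .
  qed simp
qed (simp_all only: uniformity_poly_map_def open_poly_map_def)

end

definition Poly_plus :: "poly_map set" where
  "Poly_plus = {h. \<exists>p. degree p \<ge> 2 \<and> app h = sphere_map p}"

text \<open>\<open>poly_comp [g1, ..., gn]\<close> is the composition that applies \<open>g1\<close> first and \<open>gn\<close> last.\<close>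

definition poly_comp :: "poly_map list \<Rightarrow> rsphere \<Rightarrow> rsphere" where
  "poly_comp gs = fold app gs"


section \<open>Random systems with complete connections\<close>

definition RSCC :: "'w measure \<Rightarrow> 'x measure \<Rightarrow> ('w \<Rightarrow> 'x \<Rightarrow> 'w) \<Rightarrow> ('w \<Rightarrow> 'x measure) \<Rightarrow> bool" where
  "RSCC W X u P \<longleftrightarrow>
     (\<lambda>(w, x). u w x) \<in> measurable (W \<Otimes>\<^sub>M X) W \<and> P \<in> measurable W (prob_algebra X)"

definition trans_kernel :: "('w::topological_space \<Rightarrow> 'x \<Rightarrow> 'w) \<Rightarrow> ('w \<Rightarrow> 'x measure) \<Rightarrow> 'w \<Rightarrow> 'w measure" where
  "trans_kernel u P w = distr (P w) borel (u w)"

definition trans_op :: "('w::topological_space \<Rightarrow> 'x \<Rightarrow> 'w) \<Rightarrow> ('w \<Rightarrow> 'x measure) \<Rightarrow> ('w \<Rightarrow> real) \<Rightarrow> 'w \<Rightarrow> real" where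
  "trans_op u P f w = (\<integral>w'. f w' \<partial>trans_kernel u P w)"

text \<open>The state reached from \<open>w\<close> by reading the word \<open>xs\<close> is \<open>foldl u w xs\<close>.
  Words and paths are indexed from 0. The definite descriptions in \<open>path_measure\<close> and
  \<open>tau_path\<close> are proper for every system on a finite index space: cylinders form a
  generating intersection-stable family, and existence is the Ionescu-Tulcea theorem.\<close>

definition cyl :: "'x list \<Rightarrow> (nat \<Rightarrow> 'x) set" where
  "cyl xs = {\<omega>. \<forall>i<length xs. \<omega> i = xs ! i}"

definition path_measure :: "('w \<Rightarrow> 'x \<Rightarrow> 'w) \<Rightarrow> ('w \<Rightarrow> 'x measure) \<Rightarrow> 'w \<Rightarrow> (nat \<Rightarrow> 'x) measure" where
  "path_measure u P w = (THE M.
     sets M = sets (PiM UNIV (\<lambda>_::nat. count_space (UNIV :: 'x set))) \<and> prob_space M \<and>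
     (\<forall>xs. measure M (cyl xs) =
        (\<Prod>i<length xs. measure (P (foldl u w (take i xs))) {xs ! i})))"

definition adm_words :: "('w \<Rightarrow> 'x \<Rightarrow> 'w) \<Rightarrow> ('w \<Rightarrow> 'x measure) \<Rightarrow> 'w \<Rightarrow> nat \<Rightarrow> 'x list set" where
  "adm_words u P w n = {xs. length xs = n \<and> measure (path_measure u P w) (cyl xs) > 0}"

definition msupp :: "'a::topological_space measure \<Rightarrow> 'a set" where
  "msupp M = {x. \<forall>U. open U \<longrightarrow> x \<in> U \<longrightarrow> emeasure M U > 0}"

definition Stat :: "('w::topological_space \<Rightarrow> 'x \<Rightarrow> 'w) \<Rightarrow> ('w \<Rightarrow> 'x measure) \<Rightarrow> 'w measure set" where
  "Stat u P = {\<pi>. sets \<pi> = sets borel \<and> prob_space \<pi> \<and>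
     (\<forall>A\<in>sets borel. emeasure \<pi> A = (\<integral>\<^sup>+w. emeasure (trans_kernel u P w) A \<partial>\<pi>))}"


section \<open>Polynomial systems\<close>

text \<open>Throughout, \<open>\<tau> x\<close> is a Borel probability measure on the space of non-constant polynomial
  maps and \<open>msupp (\<tau> x)\<close> is the generating set attached to the index \<open>x\<close>.\<close>

definition Hset :: "('w \<Rightarrow> 'x \<Rightarrow> 'w) \<Rightarrow> ('w \<Rightarrow> 'x measure) \<Rightarrow> ('x \<Rightarrow> poly_map measure)
    \<Rightarrow> 'w \<Rightarrow> (rsphere \<Rightarrow> rsphere) set" where
  "Hset u P \<tau> w = {poly_comp gs | gs n xs. n \<ge> 1 \<and> xs \<in> adm_words u P w n \<and> length gs = n \<and>
     (\<forall>j<n. gs ! j \<in> msupp (\<tau> (xs ! j)))}"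

definition Xi :: "('w \<Rightarrow> 'x::discrete_topology \<Rightarrow> 'w) \<Rightarrow> ('w \<Rightarrow> 'x measure) \<Rightarrow> ('x \<Rightarrow> poly_map measure)
    \<Rightarrow> 'w \<Rightarrow> (nat \<Rightarrow> poly_map \<times> 'x) set" where
  "Xi u P \<tau> w = {\<omega>. (\<lambda>n. snd (\<omega> n)) \<in> msupp (path_measure u P w) \<and>
     (\<forall>n. fst (\<omega> n) \<in> msupp (\<tau> (snd (\<omega> n))))}"

definition tau_path :: "('w \<Rightarrow> 'x::discrete_topology \<Rightarrow> 'w) \<Rightarrow> ('w \<Rightarrow> 'x measure)
    \<Rightarrow> ('x \<Rightarrow> poly_map measure) \<Rightarrow> 'w \<Rightarrow> (nat \<Rightarrow> poly_map \<times> 'x) measure" where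
  "tau_path u P \<tau> w = (THE M.
     space M = Xi u P \<tau> w \<and>
     sets M = sets (restrict_space
        (PiM UNIV (\<lambda>_::nat. (borel :: poly_map measure) \<Otimes>\<^sub>M count_space (UNIV :: 'x set)))
        (Xi u P \<tau> w)) \<and>
     prob_space M \<and>
     (\<forall>n. \<forall>xs\<in>adm_words u P w n. \<forall>A.
        (\<forall>k<n. A k \<in> sets borel \<and> A k \<subseteq> msupp (\<tau> (xs ! k))) \<longrightarrow>
        measure M {\<omega> \<in> Xi u P \<tau> w. \<forall>k<n. snd (\<omega> k) = xs ! k \<and> fst (\<omega> k) \<in> A k} =
          measure (path_measure u P w) (cyl xs) * (\<Prod>k<n. measure (\<tau> (xs ! k)) (A k))))"

definition T_inf :: "('w \<Rightarrow> 'x::discrete_topology \<Rightarrow> 'w) \<Rightarrow> ('w \<Rightarrow> 'x measure)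
    \<Rightarrow> ('x \<Rightarrow> poly_map measure) \<Rightarrow> 'w \<Rightarrow> rsphere \<Rightarrow> real" where
  "T_inf u P \<tau> w z = measure (tau_path u P \<tau> w)
     {\<omega> \<in> Xi u P \<tau> w. (\<lambda>n. poly_comp (map (\<lambda>k. fst (\<omega> k)) [0..<n]) z) \<longlonglongrightarrow> Infty}"

definition T_inf_avg :: "('w \<Rightarrow> 'x::discrete_topology \<Rightarrow> 'w) \<Rightarrow> ('w \<Rightarrow> 'x measure)
    \<Rightarrow> ('x \<Rightarrow> poly_map measure) \<Rightarrow> 'w measure \<Rightarrow> rsphere \<Rightarrow> real" where
  "T_inf_avg u P \<tau> \<pi> z = (\<integral>w. T_inf u P \<tau> w z \<partial>\<pi>)"

definition K_fill :: "('w \<Rightarrow> 'x \<Rightarrow> 'w) \<Rightarrow> ('w \<Rightarrow> 'x measure) \<Rightarrow> ('x \<Rightarrow> poly_map measure)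
    \<Rightarrow> 'w \<Rightarrow> rsphere set" where
  "K_fill u P \<tau> w = {z. bounded_in_plane ((\<lambda>g. g z) ` Hset u P \<tau> w)}"

definition K_ess :: "('w \<Rightarrow> 'x \<Rightarrow> 'w) \<Rightarrow> ('w \<Rightarrow> 'x measure) \<Rightarrow> ('x \<Rightarrow> poly_map measure)
    \<Rightarrow> 'w measure \<Rightarrow> 'w set \<Rightarrow> rsphere set" where
  "K_ess u P \<tau> \<pi> B = {z. measure \<pi> {w \<in> B. z \<in> K_fill u P \<tau> w} = measure \<pi> B}"

end

theory Submission
  imports Defs "HOL-Complex_Analysis.Conformal_Mappings"
begin

text \<open>The point is that \<open>T_inf u P \<tau> w z = 0\<close> holds exactly when \<open>z \<in> K_fill u P \<tau> w\<close>.
  Since the compact sets \<open>msupp (\<tau> x)\<close> consist of polynomials of degree at least 2, there is one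
  radius \<open>R\<close> beyond which every generator at least doubles the modulus. If some admissible
  composition moves \<open>z\<close> beyond \<open>R\<close>, then so do all compositions of generators in a neighbourhood
  of positive probability, and every continuation escapes; conversely a bounded orbit never escapes.
  If the average at \<open>z\<close> vanished, then by continuity and full support of \<open>\<pi>\<close> the escaping
  probability at \<open>z\<close> would vanish for every \<open>w\<close>, so \<open>z\<close> would lie in both essential filled-in
  sets. At a point of the first essential filled-in set the average is at most \<open>1 - \<pi>(B1)\<close>.\<close>

section \<open>Topology of the Riemann sphere\<close>

text \<open>Two obstacles shape the work. The escaping probability is measured by
  \<open>tau_path\<close>, a definite description whose formula covers only admissible words and
  sets inside the supports, and admissible words are defined through another definite description,
  \<open>path_measure\<close>. Both are read off from one measure \<open>joint w\<close> on all
  sequences of pairs (map, index), built by the Ionescu-Tulcea theorem: \<open>tau_path\<close> is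
  its restriction to \<open>Xi\<close>, \<open>path_measure\<close> its marginal on indices. For
  \<open>Xi\<close> to carry full mass, supports of Borel measures on the space of polynomial maps
  must have full measure, whence the proof that this space is second countable. The other obstacle
  is the metric: near infinity the spherical sup metric says little about ratios of moduli, yet
  doubling is a condition on such ratios. Closeness to a polynomial of degree at least 2 transfers
  only a constant lower bound on moduli outside a disc; the maximum principle turns that bound into
  doubling. A radius found for one map thus serves its neighbours, and compactness applies.\<close>

lemma chord_sq: "(norm (stereo p - stereo q))\<^sup>2 = 2 - 2 * (stereo p \<bullet> stereo q)"
  unfolding power2_norm_eq_inner using norm_stereo[of p] norm_stereo[of q]
  by (simp add: inner_diff inner_commute norm_eq_1)

lemma cos_dist_rsphere: "cos (dist p q) = stereo p \<bullet> stereo q"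
  unfolding dist_rsphere_def using Cauchy_Schwarz_ineq2[of "stereo p" "stereo q"]
  by (simp add: cos_arccos_abs norm_stereo)

text \<open>A chord subtending the angle \<open>dist p q\<close> on the unit sphere has length
  \<open>2 * sin (dist p q / 2)\<close>. Chords are algebraic in the coordinates, so estimates are
  made with them and carried over to the arccos metric.\<close>

lemma chord_le_dist: "norm (stereo p - stereo q) \<le> dist p q"
proof -
  have "(norm (stereo p - stereo q))\<^sup>2 = 2 - 2 * cos (2 * (dist p q / 2))"
    by (simp add: chord_sq cos_dist_rsphere)
  also have "\<dots> = (2 * sin (dist p q / 2))\<^sup>2"
    unfolding cos_double_sin by (simp add: power_mult_distrib)
  also have "\<dots> \<le> (dist p q)\<^sup>2"
    using abs_sin_x_le_abs_x[of "dist p q / 2"] by (subst abs_le_square_iff[symmetric]) simp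
  finally show ?thesis by (rule power2_le_imp_le) simp
qed

text \<open>The bound \<open>d\<close> depends on \<open>e\<close> alone; this uniformity lets chord
  estimates pass through the supremum in \<open>dist_poly_map\<close>.\<close>

lemma dist_less_if_chord_less:
  assumes "e > 0"
  obtains d where "d > 0" "\<And>p q. norm (stereo p - stereo q) < d \<Longrightarrow> dist p q < e"
proof
  \<comment> \<open>The chord length at angle \<open>min e pi\<close>; the cut-off at
    \<open>pi\<close> stays on the interval where the cosine decreases.\<close>
  define d where "d = sqrt (2 - 2 * cos (min e pi))"
  have "cos (min e pi) < cos 0" using assms by (intro cos_monotone_0_pi) auto
  then have pos: "2 - 2 * cos (min e pi) > 0" by simp
  then show "d > 0" unfolding d_def by simp
  show "dist p q < e" if "norm (stereo p - stereo q) < d" for p q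
  proof (rule ccontr)
    assume "\<not> dist p q < e"
    then have "cos (dist p q) \<le> cos (min e pi)"
      using assms dist_rsphere_le_pi[of p q] by (intro cos_monotone_0_pi_le) auto
    then have "d\<^sup>2 \<le> (norm (stereo p - stereo q))\<^sup>2"
      using pos by (simp add: d_def chord_sq cos_dist_rsphere)
    with that show False using power2_le_imp_le[of d "norm (stereo p - stereo q)"] by simp
  qed
qed

lemma tendsto_rsphere_iff: "(f \<longlongrightarrow> p) F \<longleftrightarrow> ((\<lambda>x. stereo (f x)) \<longlongrightarrow> stereo p) F"
proof
  assume L: "(f \<longlongrightarrow> p) F"
  show "((\<lambda>x. stereo (f x)) \<longlongrightarrow> stereo p) F"
    unfolding tendsto_iff
  proof (intro allI impI)
    fix e :: real assume "e > 0"
    with L have "\<forall>\<^sub>F x in F. dist (f x) p < e" by (rule tendstoD)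
    then show "\<forall>\<^sub>F x in F. dist (stereo (f x)) (stereo p) < e"
    proof eventually_elim
      case (elim x)
      then show ?case using chord_le_dist[of "f x" p] by (simp add: dist_norm)
    qed
  qed
next
  assume R: "((\<lambda>x. stereo (f x)) \<longlongrightarrow> stereo p) F"
  show "(f \<longlongrightarrow> p) F"
    unfolding tendsto_iff
  proof (intro allI impI)
    fix e :: real assume "e > 0"
    from dist_less_if_chord_less[OF this] obtain d where d: "d > 0"
      "\<And>p q. norm (stereo p - stereo q) < d \<Longrightarrow> dist p q < e" by blast
    from R d(1) have "\<forall>\<^sub>F x in F. dist (stereo (f x)) (stereo p) < d" by (rule tendstoD)
    then show "\<forall>\<^sub>F x in F. dist (f x) p < e"
      by eventually_elim (rule d(2), simp add: dist_norm)
  qed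
qed

lemma continuous_stereo: "continuous_on UNIV stereo"
  unfolding continuous_on_def
proof
  fix p show "(stereo \<longlongrightarrow> stereo p) (at p within UNIV)"
    by (rule tendsto_rsphere_iff[THEN iffD1, OF tendsto_ident_at])
qed

lemma second_countable_if_countable_basis:
  fixes B :: "'a::topological_space set set"
  assumes "countable B" "topological_basis B"
  shows "\<exists>B::'a set set. countable B \<and> open = generate_topology B"
  using assms(1) topological_basis_imp_subbasis[OF assms(2)] by (intro exI[of _ B] conjI) auto

text \<open>\<open>stereo\<close> is a topological embedding, so a countable basis pulls back. In
  \<open>orbit_measurable\<close> this allows a continuous function of two measurable maps to be
  recognised as measurable.\<close>

instance rsphere :: second_countable_topology
proof
  obtain B :: "(complex \<times> real) set set" where B: "countable B" "topological_basis B"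
    using ex_countable_basis by blast
  let ?B = "(\<lambda>b. stereo -` b) ` B"
  have "topological_basis ?B"
  proof (rule topological_basisI)
    fix b assume "b \<in> ?B"
    then show "open b"
      using B(2) continuous_stereo by (auto intro!: open_vimage simp: topological_basis_open)
  next
    fix U :: "rsphere set" and p assume U: "open U" "p \<in> U"
    then obtain e where e: "e > 0" "\<And>q. dist q p < e \<Longrightarrow> q \<in> U" unfolding open_dist by blast
    from dist_less_if_chord_less[OF e(1)] obtain d where d: "d > 0"
      "\<And>p q. norm (stereo p - stereo q) < d \<Longrightarrow> dist p q < e" by blast
    obtain b where b: "b \<in> B" "stereo p \<in> b" "b \<subseteq> ball (stereo p) d"
      using topological_basisE[OF B(2), of "ball (stereo p) d" "stereo p"] d(1) by auto
    have "stereo -` b \<subseteq> U"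
    proof
      fix q assume "q \<in> stereo -` b"
      then have "norm (stereo q - stereo p) < d" using b(3) by (auto simp: dist_norm norm_minus_commute)
      then show "q \<in> U" by (intro e(2) d(2))
    qed
    with b show "\<exists>b\<in>?B. p \<in> b \<and> b \<subseteq> U" by auto
  qed
  with B(1) show "\<exists>B::rsphere set set. countable B \<and> open = generate_topology B"
    by (intro second_countable_if_countable_basis[of ?B]) auto
qed

lemma chord_Fin_Infty: "(norm (stereo (Fin a) - stereo Infty))\<^sup>2 = 4 / (1 + (cmod a)\<^sup>2)"
proof -
  have "1 + (cmod a)\<^sup>2 > 0" by (simp add: add_pos_nonneg)
  then show ?thesis unfolding chord_sq by (simp add: field_simps)
qed

lemma chord_Fin_Fin:
  "(norm (stereo (Fin a) - stereo (Fin b)))\<^sup>2 = 4 * (cmod (a - b))\<^sup>2 / ((1 + (cmod a)\<^sup>2) * (1 + (cmod b)\<^sup>2))"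
proof -
  define A B where "A = 1 + (cmod a)\<^sup>2" and "B = 1 + (cmod b)\<^sup>2"
  have pos: "A > 0" "B > 0" by (simp_all add: A_def B_def add_pos_nonneg)
  have ab: "(cmod (a - b))\<^sup>2 = (A - 1) + (B - 1) - 2 * (a \<bullet> b)"
    unfolding A_def B_def power2_norm_eq_inner by (simp add: inner_diff inner_commute)
  have st: "stereo (Fin a) = ((2 / A) *\<^sub>R a, (A - 2) / A)" "stereo (Fin b) = ((2 / B) *\<^sub>R b, (B - 2) / B)"
    by (simp_all add: A_def B_def add.commute)
  have inn: "stereo (Fin a) \<bullet> stereo (Fin b) = 4 * (a \<bullet> b) / (A * B) + (A - 2) * (B - 2) / (A * B)"
    unfolding st by (simp add: inner_Pair)
  have "2 - 2 * (stereo (Fin a) \<bullet> stereo (Fin b)) = (2 * A * B - 8 * (a \<bullet> b) - 2 * (A - 2) * (B - 2)) / (A * B)"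
    unfolding inn using pos by (simp add: field_simps)
  also have "2 * A * B - 8 * (a \<bullet> b) - 2 * (A - 2) * (B - 2) = 4 * (cmod (a - b))\<^sup>2"
    unfolding ab by (simp add: algebra_simps)
  finally show ?thesis unfolding chord_sq A_def B_def .
qed

text \<open>In \<open>chord_Fin_Fin\<close> the factor belonging to \<open>b\<close> is at least 1
  and is dropped; the one belonging to \<open>a\<close> is kept, to absorb differences that grow
  with \<open>a\<close>.\<close>

lemma chord_Fin_le:
  "norm (stereo (Fin a) - stereo (Fin b)) \<le> 2 * cmod (a - b) / sqrt (1 + (cmod a)\<^sup>2)"
proof (rule power2_le_imp_le)
  have "1 + (cmod a)\<^sup>2 > 0" "1 + (cmod b)\<^sup>2 > 0" by (simp_all add: add_pos_nonneg)
  then show "(norm (stereo (Fin a) - stereo (Fin b)))\<^sup>2 \<le> (2 * cmod (a - b) / sqrt (1 + (cmod a)\<^sup>2))\<^sup>2"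
    unfolding chord_Fin_Fin power_divide power_mult_distrib
    by (simp, intro divide_left_mono) (auto simp: mult_le_cancel_left1 intro!: mult_pos_pos)
qed simp

lemma continuous_Fin: "continuous_on UNIV Fin"
  unfolding continuous_on_def
proof
  fix a :: complex
  have "((\<lambda>b. 2 * cmod (a - b) / sqrt (1 + (cmod a)\<^sup>2)) \<longlongrightarrow> 2 * cmod (a - a) / sqrt (1 + (cmod a)\<^sup>2)) (at a)"
    by (intro tendsto_intros) (simp add: add_nonneg_eq_0_iff)
  then have "((\<lambda>b. 2 * cmod (a - b) / sqrt (1 + (cmod a)\<^sup>2)) \<longlongrightarrow> 0) (at a)" by simp
  then have "((\<lambda>b. stereo (Fin b) - stereo (Fin a)) \<longlongrightarrow> 0) (at a)"
    by (rule Lim_null_comparison[rotated])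
       (intro always_eventually allI, metis chord_Fin_le norm_minus_commute)
  then show "(Fin \<longlongrightarrow> Fin a) (at a)"
    unfolding tendsto_rsphere_iff by (simp add: LIM_zero_iff del: stereo.simps)
qed

lemma tendsto_Fin_Infty:
  assumes "filterlim f at_infinity F"
  shows "((\<lambda>x. Fin (f x)) \<longlongrightarrow> Infty) F"
proof -
  have "filterlim (\<lambda>x. cmod (f x)) at_top F"
    using assms by (simp add: filterlim_at_infinity_conv_norm_at_top)
  then have "filterlim (\<lambda>x. 1 + (cmod (f x))\<^sup>2) at_top F"
    by (intro filterlim_tendsto_add_at_top[OF tendsto_const] filterlim_pow_at_top) auto
  then have "((\<lambda>x. 4 / (1 + (cmod (f x))\<^sup>2)) \<longlongrightarrow> 0) F"
    by (intro tendsto_divide_0[OF tendsto_const] filterlim_at_top_imp_at_infinity)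
  then have "((\<lambda>x. sqrt ((norm (stereo (Fin (f x)) - stereo Infty))\<^sup>2)) \<longlongrightarrow> sqrt 0) F"
    unfolding chord_Fin_Infty by (intro tendsto_real_sqrt)
  then show ?thesis
    unfolding tendsto_rsphere_iff by (simp add: tendsto_norm_zero_iff LIM_zero_iff del: stereo.simps)
qed

section \<open>Neighbourhoods of infinity and continuity of polynomial maps\<close>

definition near_infty :: "real \<Rightarrow> rsphere set" where
  "near_infty R = - Fin ` cball 0 R"

lemma open_near_infty: "open (near_infty R)"
proof -
  have "compact (Fin ` cball 0 R)"
    by (intro compact_continuous_image continuous_on_subset[OF continuous_Fin]) auto
  then show ?thesis unfolding near_infty_def by (auto intro: compact_imp_closed)
qed

lemma near_infty_simps [simp]: "Infty \<in> near_infty R" "Fin a \<in> near_infty R \<longleftrightarrow> R < cmod a"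
  by (auto simp: near_infty_def)

text \<open>Convergence of \<open>Fin a\<close> to \<open>Infty\<close> for growing \<open>a\<close>
  says that the sets \<open>near_infty R\<close> form a neighbourhood base at
  \<open>Infty\<close>.\<close>

lemma tendsto_InftyI:
  assumes "\<And>R. \<forall>\<^sub>F x in F. f x \<in> near_infty R"
  shows "(f \<longlongrightarrow> Infty) F"
proof (rule topological_tendstoI)
  fix U assume U: "open U" "Infty \<in> U"
  have "((\<lambda>a. Fin a) \<longlongrightarrow> Infty) at_infinity" by (rule tendsto_Fin_Infty) (rule filterlim_ident)
  from topological_tendstoD[OF this U] obtain R where R: "\<And>a. R \<le> cmod a \<Longrightarrow> Fin a \<in> U"
    unfolding eventually_at_infinity by auto
  show "\<forall>\<^sub>F x in F. f x \<in> U"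
    using assms[of R]
  proof eventually_elim
    case (elim x)
    then show ?case using R U(2) by (cases "f x") auto
  qed
qed

text \<open>Inverse stereographic projection; the value at \<open>Infty\<close> is the junk value \<open>1 / 0 = 0\<close>.\<close>

definition unfin :: "rsphere \<Rightarrow> complex" where
  "unfin p = (1 / (1 - snd (stereo p))) *\<^sub>R fst (stereo p)"

lemma unfin_Fin [simp]: "unfin (Fin z) = z"
proof -
  define r where "r = (cmod z)\<^sup>2"
  have "r \<ge> 0" by (simp add: r_def)
  then have "1 / (1 - (r - 1) / (r + 1)) * (2 / (1 + r)) = 1" by (simp add: field_simps)
  then show ?thesis unfolding unfin_def stereo.simps fst_conv snd_conv scaleR_scaleR r_def by simp
qed

lemma isCont_unfin: "isCont unfin (Fin z)"
proof -
  have "isCont stereo (Fin z)"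
    using continuous_stereo by (simp add: continuous_on_eq_continuous_at del: stereo.simps)
  moreover have "1 - snd (stereo (Fin z)) \<noteq> 0"
  proof
    assume "1 - snd (stereo (Fin z)) = 0"
    moreover have "(cmod z)\<^sup>2 + 1 > 0" by (simp add: add_nonneg_pos)
    ultimately show False by (simp add: field_simps)
  qed
  ultimately show ?thesis unfolding unfin_def
    by (intro continuous_intros)
qed

text \<open>Near a finite point the map is the composition of \<open>unfin\<close>, the polynomial
  and \<open>Fin\<close>; at \<open>Infty\<close> continuity is the divergence of a non-constant
  polynomial.\<close>

lemma sphere_map_continuous:
  assumes "degree p \<ge> 1"
  shows "continuous_on UNIV (sphere_map p)"
  unfolding continuous_on_eq_continuous_at[OF open_UNIV]
proof
  fix z show "isCont (sphere_map p) z"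
  proof (cases z)
    case (Fin a)
    have "isCont Fin (poly p (unfin (Fin a)))"
      using continuous_Fin by (simp add: continuous_on_eq_continuous_at)
    then have "isCont (\<lambda>q. Fin (poly p (unfin q))) (Fin a)"
      by (rule isCont_o2[OF isCont_o2[OF isCont_unfin poly_isCont]])
    moreover have "\<forall>\<^sub>F q in nhds (Fin a). sphere_map p q = Fin (poly p (unfin q))"
    proof -
      have "\<forall>\<^sub>F q in nhds (Fin a). q \<in> - {Infty}" by (rule eventually_nhds_in_open) auto
      then show ?thesis
      proof eventually_elim
        case (elim q)
        then show ?case by (cases q) auto
      qed
    qed
    ultimately show ?thesis unfolding Fin by (subst isCont_cong)
  next
    case Infty
    have "(sphere_map p \<longlongrightarrow> Infty) (at Infty)"
    proof (rule tendsto_InftyI)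
      fix R
      have "filterlim (poly p) at_infinity at_infinity"
        using assms by (intro filterlim_poly_at_infinity) auto
      then have "\<forall>\<^sub>F x in at_infinity. cmod (poly p x) > R"
        unfolding filterlim_at_infinity_conv_norm_at_top
        by (simp add: filterlim_at_top_dense)
      then obtain R' where R': "\<And>x. R' \<le> cmod x \<Longrightarrow> cmod (poly p x) > R"
        by (auto simp: eventually_at_infinity)
      have "\<forall>\<^sub>F q in nhds Infty. q \<in> near_infty R'"
        by (rule eventually_nhds_in_open) (auto simp: open_near_infty)
      then have "\<forall>\<^sub>F q in nhds Infty. sphere_map p q \<in> near_infty R"
      proof eventually_elim
        case (elim q)
        then show ?case using R' by (cases q) auto
      qed
      then show "\<forall>\<^sub>F q in at Infty. sphere_map p q \<in> near_infty R"
        by (rule eventually_nhds_conv_at[THEN iffD1, THEN conjunct1])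
    qed
    then show ?thesis using Infty by (simp add: isCont_def)
  qed
qed

section \<open>Topology of the space of polynomial maps\<close>

lemma app_eq_sphere_map: obtains p where "degree p \<ge> 1" "app f = sphere_map p"
  using app[of f] by auto

lemma app_Infty [simp]: "app f Infty = Infty"
  by (rule app_eq_sphere_map[of f]) simp

lemma app_continuous: "continuous_on UNIV (app f)"
  by (rule app_eq_sphere_map[of f]) (simp add: sphere_map_continuous)

lemma dist_app_le: "dist (app f z) (app g z) \<le> dist f g"
  unfolding dist_poly_map_def
  by (rule cSUP_upper) (auto intro!: bdd_aboveI2 dist_rsphere_le_pi)

text \<open>The sup metric controls a change of the map uniformly in the point, which leaves only
  continuity of the fixed map \<open>g\<close> at \<open>z\<close>. Joint continuity gives both
  measurable orbits and \<open>poly_comp_open\<close>.\<close>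

lemma app_continuous_pair: "continuous_on UNIV (\<lambda>x. app (fst x) (snd x))"
  unfolding continuous_on_def
proof
  fix x :: "poly_map \<times> rsphere"
  obtain g z where x: "x = (g, z)" by force
  have g: "isCont (app g) z" using app_continuous[of g] by (simp add: continuous_on_eq_continuous_at)
  have "(snd \<longlongrightarrow> z) (at x)" using tendsto_snd[OF tendsto_ident_at[of x UNIV]] by (simp add: x)
  with g have "((\<lambda>y. app g (snd y)) \<longlongrightarrow> app g z) (at x)" by (rule isCont_tendsto_compose)
  then have 1: "((\<lambda>y. dist (app g (snd y)) (app g z)) \<longlongrightarrow> 0) (at x)"
    by (rule tendsto_dist_iff[THEN iffD1])
  have "((\<lambda>y. dist (fst y) g) \<longlongrightarrow> dist (fst x) g) (at x)"
    by (intro tendsto_intros)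
  then have "((\<lambda>y. dist (fst y) g + dist (app g (snd y)) (app g z)) \<longlongrightarrow> 0 + 0) (at x)"
    by (intro tendsto_add 1) (simp add: x)
  moreover have "dist (app (fst y) (snd y)) (app g z) \<le> dist (fst y) g + dist (app g (snd y)) (app g z)" for y
    using dist_triangle[of "app (fst y) (snd y)" "app g z" "app g (snd y)"] dist_app_le[of "fst y" "snd y" g]
    by linarith
  ultimately have "((\<lambda>y. dist (app (fst y) (snd y)) (app g z)) \<longlongrightarrow> 0) (at x)"
    using tendsto_sandwich[of "\<lambda>_. 0" "\<lambda>y. dist (app (fst y) (snd y)) (app g z)" "at x"
        "\<lambda>y. dist (fst y) g + dist (app g (snd y)) (app g z)" 0] by simp
  then show "((\<lambda>x. app (fst x) (snd x)) \<longlongrightarrow> app (fst x) (snd x)) (at x within UNIV)"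
    using tendsto_dist_iff[of "\<lambda>x. app (fst x) (snd x)" "app g z" "at x"] by (simp add: x)
qed

section \<open>Separability of the space of polynomial maps\<close>

lemma poly_growth:
  fixes p :: "complex poly"
  assumes "p \<noteq> 0"
  obtains c R where "c > 0" "R \<ge> 1" "\<And>z. R \<le> cmod z \<Longrightarrow> c * cmod z ^ degree p \<le> cmod (poly p z)"
proof -
  define c where "c = cmod (lead_coeff p) / 2"
  have c: "c > 0" "c < cmod (lead_coeff p)" using assms by (auto simp: c_def)
  have "((\<lambda>x. cmod (poly p x / x ^ degree p)) \<longlongrightarrow> cmod (lead_coeff p)) at_infinity"
    by (intro tendsto_norm poly_divide_tendsto_aux)
  from order_tendstoD(1)[OF this c(2)] obtain R where
    R: "\<And>x. R \<le> cmod x \<Longrightarrow> c < cmod (poly p x / x ^ degree p)"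
    by (auto simp: eventually_at_infinity)
  show thesis
  proof (rule that[of c "max R 1"])
    fix z assume z: "max R 1 \<le> cmod z"
    then have "z \<noteq> 0" by auto
    then show "c * cmod z ^ degree p \<le> cmod (poly p z)"
      using R[of z] z by (simp add: norm_divide norm_power field_simps)
  qed (use c in auto)
qed

text \<open>Together with \<open>chord_Fin_le\<close> this turns closeness of coefficients into closeness in the spherical
  sup metric, without a case distinction near infinity.\<close>

lemma power_sum_le_poly:
  fixes p :: "complex poly"
  assumes "p \<noteq> 0"
  obtains C where "C > 0" "\<And>z. (\<Sum>i\<le>degree p. cmod z ^ i) \<le> C * sqrt (1 + (cmod (poly p z))\<^sup>2)"
proof -
  let ?d = "degree p"
  from poly_growth[OF assms] obtain c R where c: "c > 0" "R \<ge> 1"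
    and cR: "\<And>z. R \<le> cmod z \<Longrightarrow> c * cmod z ^ ?d \<le> cmod (poly p z)" by blast
  \<comment> \<open>The first summand serves \<open>cmod z < R\<close>, where every power is at most
    \<open>R ^ degree p\<close>; the second serves the rest, where every power is at most
    \<open>cmod (poly p z) / c\<close>.\<close>
  define C where "C = (real ?d + 1) * R ^ ?d + (real ?d + 1) / c"
  have C: "C \<ge> (real ?d + 1) * R ^ ?d" "C \<ge> (real ?d + 1) / c"
    using c by (auto simp: C_def)
  have "(real ?d + 1) / c > 0" using c by simp
  with C have C0: "C > 0" by linarith
  show thesis
  proof (rule that[OF C0])
    fix z
    let ?s = "sqrt (1 + (cmod (poly p z))\<^sup>2)"
    have s: "?s \<ge> 1" "?s \<ge> cmod (poly p z)" by (auto intro: real_le_rsqrt)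
    show "(\<Sum>i\<le>?d. cmod z ^ i) \<le> C * ?s"
    proof (cases "R \<le> cmod z")
      case True
      have "(\<Sum>i\<le>?d. cmod z ^ i) \<le> (\<Sum>i\<le>?d. cmod z ^ ?d)"
        using True c by (intro sum_mono power_increasing) auto
      also have "\<dots> = (real ?d + 1) / c * (c * cmod z ^ ?d)" using c by (simp add: field_simps)
      also have "\<dots> \<le> C * ?s"
        using cR[OF True] C s c C0 by (intro mult_mono) auto
      finally show ?thesis .
    next
      case False
      have "(\<Sum>i\<le>?d. cmod z ^ i) \<le> (\<Sum>i\<le>?d. R ^ ?d)"
      proof (rule sum_mono)
        fix i assume "i \<in> {..?d}"
        then have "cmod z ^ i \<le> R ^ i" "R ^ i \<le> R ^ ?d"
          using False c by (auto intro: power_mono power_increasing)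
        then show "cmod z ^ i \<le> R ^ ?d" by linarith
      qed
      also have "\<dots> = (real ?d + 1) * R ^ ?d * 1" by simp
      also have "\<dots> \<le> C * ?s" using C s c C0 by (intro mult_mono) auto
      finally show ?thesis .
    qed
  qed
qed

lemma second_countable_if_countable_dense:
  fixes D :: "'a::metric_space set"
  assumes "countable D" and dense: "\<And>x e. e > 0 \<Longrightarrow> \<exists>d\<in>D. dist d x < e"
  shows "\<exists>B::'a set set. countable B \<and> open = generate_topology B"
proof (rule second_countable_if_countable_basis)
  let ?B = "(\<lambda>(d, n). ball d (1 / real (Suc n))) ` (D \<times> UNIV)"
  show "countable ?B" using assms(1) by auto
  show "topological_basis ?B"
  proof (rule topological_basisI)
    fix U :: "'a set" and x assume "open U" "x \<in> U"
    then obtain e where e: "e > 0" "ball x e \<subseteq> U" unfolding open_contains_ball by blast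
    then obtain n where n: "1 / real (Suc n) < e / 2"
      using nat_approx_posE[of "e/2"] by auto
    obtain d where d: "d \<in> D" "dist d x < 1 / real (Suc n)" using dense[of "1 / real (Suc n)" x] by auto
    have "ball d (1 / real (Suc n)) \<subseteq> ball x e"
    proof
      fix y assume "y \<in> ball d (1 / real (Suc n))"
      then show "y \<in> ball x e"
        using dist_triangle[of x y d] d(2) n by (simp add: dist_commute)
    qed
    then show "\<exists>b\<in>?B. x \<in> b \<and> b \<subseteq> U"
      using d e(2) by (intro bexI[of _ "ball d (1 / real (Suc n))"]) auto
  qed auto
qed

text \<open>By \<open>power_sum_le_poly\<close>, perturbing the coefficients changes a value by at
  most a small multiple of the denominator in \<open>chord_Fin_le\<close>. The chordal error is
  therefore uniform over the plane, and both maps fix \<open>Infty\<close>.\<close>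

lemma poly_map_approx:
  fixes D :: "complex set"
  assumes dense: "\<And>X. open X \<Longrightarrow> X \<noteq> {} \<Longrightarrow> \<exists>d\<in>D. d \<in> X" and e: "e > 0"
  shows "\<exists>xs\<in>lists D. dist (Abs_poly_map (sphere_map (Poly xs))) f < e"
proof -
  obtain p where p: "degree p \<ge> 1" "app f = sphere_map p" by (rule app_eq_sphere_map)
  then have "p \<noteq> 0" by auto
  from power_sum_le_poly[OF this] obtain C where C: "C > 0"
    "\<And>z. (\<Sum>i\<le>degree p. cmod z ^ i) \<le> C * sqrt (1 + (cmod (poly p z))\<^sup>2)" by blast
  \<comment> \<open>Half of \<open>e\<close>, since the supremum of distances below a bound need not
    stay strictly below it.\<close>
  have "e / 2 > 0" using e by simp
  from dist_less_if_chord_less[OF this] obtain d where d: "d > 0"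
    "\<And>p q. norm (stereo p - stereo q) < d \<Longrightarrow> dist p q < e / 2" by blast
  \<comment> \<open>The chord estimate below comes to \<open>2 * \<delta> * C\<close>, two thirds of
    \<open>d\<close>.\<close>
  define \<delta> where "\<delta> = d / (3 * C)"
  have \<delta>: "\<delta> > 0" using d C by (simp add: \<delta>_def)
  \<comment> \<open>Excluding 0 keeps the leading coefficient nonzero, so the perturbed polynomial
    has the same degree.\<close>
  have "\<exists>q\<in>D. q \<in> ball (coeff p i) \<delta> - {0}" for i
  proof (rule dense)
    have "infinite (ball (coeff p i) \<delta>)"
      using \<delta> uncountable_ball[of \<delta> "coeff p i"] countable_finite by blast
    then show "ball (coeff p i) \<delta> - {0} \<noteq> {}"
      by (metis finite.emptyI finite.insertI finite_Diff2)
  qed auto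
  then obtain Q where Q: "\<And>i. Q i \<in> D" "\<And>i. Q i \<in> ball (coeff p i) \<delta> - {0}" by metis
  define xs where "xs = map Q [0..<Suc (degree p)]"
  define q where "q = Poly xs"
  have coeff_q: "coeff q i = (if i \<le> degree p then Q i else 0)" for i
    by (auto simp: q_def xs_def nth_default_def simp del: upt_Suc)
  have "degree q = degree p"
    using Q(2)[of "degree p"] by (intro antisym degree_le le_degree) (auto simp: coeff_q)
  have lt: "cmod (poly p z - poly q z) \<le> \<delta> * (\<Sum>i\<le>degree p. cmod z ^ i)" for z
  proof -
    have "poly p z - poly q z = (\<Sum>i\<le>degree p. (coeff p i - coeff q i) * z ^ i)"
      unfolding poly_altdef \<open>degree q = degree p\<close> by (simp add: sum_subtractf left_diff_distrib)
    also have "cmod \<dots> \<le> (\<Sum>i\<le>degree p. \<delta> * cmod z ^ i)"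
    proof (rule sum_norm_le)
      fix i assume "i \<in> {..degree p}"
      then have "cmod (coeff p i - coeff q i) \<le> \<delta>" using Q(2)[of i] by (simp add: coeff_q dist_norm)
      then show "cmod ((coeff p i - coeff q i) * z ^ i) \<le> \<delta> * cmod z ^ i"
        by (simp add: norm_mult norm_power mult_right_mono)
    qed
    finally show ?thesis by (simp add: sum_distrib_left)
  qed
  have app_q: "app (Abs_poly_map (sphere_map q)) = sphere_map q"
    using p(1) \<open>degree q = degree p\<close> by (intro Abs_poly_map_inverse) (auto intro!: exI[of _ q])
  have "dist (app (Abs_poly_map (sphere_map q)) z) (app f z) \<le> e / 2" for z
  proof (cases z)
    case (Fin a)
    let ?s = "sqrt (1 + (cmod (poly p a))\<^sup>2)"
    have s: "?s > 0" by (simp add: add_pos_nonneg)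
    have "norm (stereo (Fin (poly p a)) - stereo (Fin (poly q a))) \<le> 2 * cmod (poly p a - poly q a) / ?s"
      by (rule chord_Fin_le)
    also have "\<dots> \<le> 2 * (\<delta> * (C * ?s)) / ?s"
      using lt[of a] C(2)[of a] \<delta> s
      by (intro divide_right_mono mult_left_mono) (auto intro: order_trans mult_left_mono)
    also have "\<dots> < d" using s C d by (simp add: \<delta>_def)
    finally show ?thesis using d(2) Fin unfolding app_q p(2) by (metis dist_commute less_imp_le sphere_map.simps(1))
  qed (use e in simp)
  then have "dist (Abs_poly_map (sphere_map q)) f \<le> e / 2"
    unfolding dist_poly_map_def by (intro cSUP_least) auto
  moreover have "xs \<in> lists D" using Q(1) by (auto simp: xs_def)
  ultimately show ?thesis using e unfolding q_def by force
qed

instance poly_map :: second_countable_topology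
proof
  obtain D :: "complex set" where D: "countable D" "\<And>X. open X \<Longrightarrow> X \<noteq> {} \<Longrightarrow> \<exists>d\<in>D. d \<in> X"
    by (rule countable_dense_setE) blast
  show "\<exists>B::poly_map set set. countable B \<and> open = generate_topology B"
  proof (rule second_countable_if_countable_dense)
    show "countable ((\<lambda>xs. Abs_poly_map (sphere_map (Poly xs))) ` lists D)"
      using D(1) by (intro countable_image countable_lists)
    show "\<exists>d\<in>(\<lambda>xs. Abs_poly_map (sphere_map (Poly xs))) ` lists D. dist d x < e" if "e > 0" for x e
      using poly_map_approx[OF D(2) that, of x] by blast
  qed
qed

section \<open>A uniform escape radius\<close>

text \<open>Linear doubling, weaker than the true growth, survives an enlargement of
  \<open>R\<close> and iterates to powers of 2. Writing the image as \<open>Fin v\<close> avoids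
  choosing a polynomial that represents \<open>g\<close>.\<close>

definition expands :: "real \<Rightarrow> poly_map \<Rightarrow> bool" where
  "expands R g \<longleftrightarrow> (\<forall>y v. R \<le> cmod y \<longrightarrow> app g (Fin y) = Fin v \<longrightarrow> 2 * cmod y \<le> cmod v)"

text \<open>Maximum principle for \<open>y / q y\<close> outside the disc of radius \<open>R\<close>, written in the coordinate
  \<open>s = 1 / y\<close>: the bound on the circle \<open>cmod y = R\<close> propagates to infinity.\<close>

lemma poly_expands:
  fixes q :: "complex poly"
  assumes q: "degree q \<ge> 1" and R: "R > 0"
    and large: "\<And>y. R \<le> cmod y \<Longrightarrow> 2 * R < cmod (poly q y)"
    and y: "R \<le> cmod y"
  shows "2 * cmod y \<le> cmod (poly q y)"
proof -
  define r where "r = reflect_poly q"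
  \<comment> \<open>This is \<open>(1 / s) / q (1 / s)\<close> with its removable singularity at 0
    filled in: there the reflected polynomial takes the nonzero leading coefficient of
    \<open>q\<close>.\<close>
  define F where "F s = s ^ (degree q - 1) / poly r s" for s
  have q0: "q \<noteq> 0" using q by auto
  have inv: "R \<le> cmod (inverse s)" if "s \<in> cball 0 (1 / R)" "s \<noteq> 0" for s
    unfolding norm_inverse using that R by (simp add: field_simps)
  have F_eq: "F s = inverse s / poly q (inverse s)" if "s \<noteq> 0" for s
  proof -
    have "s ^ degree q = s ^ (degree q - 1) * s" using q by (metis Suc_diff_1 less_eq_Suc_le One_nat_def power_Suc2)
    then show ?thesis
      using that by (simp add: F_def r_def poly_reflect_poly_nz field_simps)
  qed
  have nz: "poly r s \<noteq> 0" if "s \<in> cball 0 (1 / R)" for s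
  proof (cases "s = 0")
    case True
    then show ?thesis using q0 by (simp add: r_def)
  next
    case False
    then show ?thesis using large[OF inv[OF that False]] R by (auto simp: r_def poly_reflect_poly_nz)
  qed
  have s: "inverse y \<in> cball 0 (1 / R)"
    using le_imp_inverse_le[OF y R] by (simp add: norm_inverse inverse_eq_divide norm_divide)
  have "y \<noteq> 0" using y R by auto
  have "norm (F (inverse y)) \<le> 1 / 2"
  proof (rule maximum_modulus_frontier[where f = F and S = "cball 0 (1 / R)"])
    show "F holomorphic_on interior (cball 0 (1 / R))"
      unfolding F_def using nz interior_subset
      by (intro holomorphic_intros) blast
    show "continuous_on (closure (cball 0 (1 / R))) F"
      unfolding F_def using nz by (intro continuous_intros) auto
    fix s :: complex assume s: "s \<in> frontier (cball 0 (1 / R))"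
    then have c: "cmod s = 1 / R" using R by (simp add: frontier_cball)
    then have "s \<noteq> 0" using R by auto
    moreover have "2 * R < cmod (poly q (inverse s))"
      using c R by (intro large) (simp add: norm_inverse)
    moreover have "norm (F s) = R / cmod (poly q (inverse s))"
      using F_eq[OF \<open>s \<noteq> 0\<close>] c R by (simp only: norm_divide norm_inverse) simp
    moreover have "R / b \<le> 1 / 2" if "2 * R < b" for b using that R by (simp add: field_simps)
    ultimately show "norm (F s) \<le> 1 / 2" by metis
  qed (use s in auto)
  moreover have "cmod (poly q y) > 0" using large[OF y] R by auto
  moreover have "norm (F (inverse y)) = cmod y / cmod (poly q y)"
    using F_eq[of "inverse y"] \<open>y \<noteq> 0\<close> by (simp add: norm_divide)
  moreover have "2 * a \<le> b" if "a / b \<le> 1 / 2" "b > 0" for a b :: real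
    using that by (simp add: field_simps)
  ultimately show ?thesis by metis
qed

text \<open>From closeness of \<open>g\<close> to \<open>h\<close> it is only extracted that
  \<open>g\<close> sends points outside the disc of radius \<open>R\<close> beyond radius
  \<open>2 * R\<close>; degrees and coefficients of the two maps are never compared.
  \<open>poly_expands\<close> upgrades this crude bound to doubling.\<close>

lemma locally_expands:
  assumes "h \<in> Poly_plus"
  obtains R e where "R \<ge> 1" "e > 0" "\<And>g. dist g h < e \<Longrightarrow> expands R g"
proof -
  from assms obtain p where p: "degree p \<ge> 2" "app h = sphere_map p" by (auto simp: Poly_plus_def)
  then have "p \<noteq> 0" by auto
  from poly_growth[OF this] obtain c R0 where c: "c > 0" "R0 \<ge> 1"
    and cR: "\<And>z. R0 \<le> cmod z \<Longrightarrow> c * cmod z ^ degree p \<le> cmod (poly p z)" by blast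
  \<comment> \<open>The choice gives \<open>c * R \<ge> 3\<close>; with degree at least 2 this puts
    the images under \<open>h\<close> at modulus at least \<open>3 * R\<close>, leaving a margin
    above \<open>2 * R\<close> for the perturbation.\<close>
  define R where "R = max R0 (3 / c)"
  have R: "R \<ge> R0" "3 / c \<le> R" by (auto simp: R_def)
  with c have R: "R \<ge> 1" "R \<ge> R0" "c * R \<ge> 3" by (auto simp: field_simps)
  have large: "3 * R \<le> cmod (poly p y)" if "R \<le> cmod y" for y
  proof -
    have "3 * R \<le> (c * R) * R" using R by (intro mult_right_mono) auto
    also have "\<dots> = c * R ^ 2" by (simp add: power2_eq_square)
    also have "\<dots> \<le> c * cmod y ^ 2" using that R c by (intro mult_left_mono power_mono) auto
    also have "\<dots> \<le> c * cmod y ^ degree p"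
      using that R c p by (intro mult_left_mono power_increasing) auto
    also have "\<dots> \<le> cmod (poly p y)" using that R by (intro cR) auto
    finally show ?thesis .
  qed
  \<comment> \<open>The gap between the chordal distances to \<open>Infty\<close> of the circles of
    radii \<open>2 * R\<close> and \<open>3 * R\<close>; a map closer than \<open>e\<close> to
    \<open>h\<close> cannot bridge it.\<close>
  define e where "e = 2 / sqrt (1 + (2 * R)\<^sup>2) - 2 / sqrt (1 + (3 * R)\<^sup>2)"
  have chord: "norm (stereo (Fin a) - stereo Infty) = 2 / sqrt (1 + (cmod a)\<^sup>2)" for a
    using arg_cong[OF chord_Fin_Infty[of a], of sqrt] by (simp add: real_sqrt_divide del: stereo.simps)
  have "sqrt (1 + (2 * R)\<^sup>2) < sqrt (1 + (3 * R)\<^sup>2)" using R by (simp add: power_mult_distrib)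
  then have e: "e > 0" unfolding e_def by (simp add: frac_less2 add_pos_nonneg)
  show thesis
  proof (rule that[OF R(1) e])
    fix g assume g: "dist g h < e"
    obtain q where q: "degree q \<ge> 1" "app g = sphere_map q" by (rule app_eq_sphere_map)
    have "2 * R < cmod (poly q y)" if y: "R \<le> cmod y" for y
    proof (rule ccontr)
      assume "\<not> 2 * R < cmod (poly q y)"
      then have "2 / sqrt (1 + (2 * R)\<^sup>2) \<le> norm (stereo (Fin (poly q y)) - stereo Infty)"
        unfolding chord by (intro divide_left_mono real_sqrt_le_mono add_left_mono power_mono) (auto simp: add_pos_nonneg)
      moreover have "norm (stereo (Fin (poly p y)) - stereo Infty) \<le> 2 / sqrt (1 + (3 * R)\<^sup>2)"
        unfolding chord using large[OF y] R
        by (intro divide_left_mono real_sqrt_le_mono add_left_mono power_mono) (auto simp: add_pos_nonneg)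
      moreover have "norm (stereo (Fin (poly q y)) - stereo (Fin (poly p y))) < e"
        using chord_le_dist[of "Fin (poly q y)" "Fin (poly p y)"] dist_app_le[of g "Fin y" h] g
        unfolding q(2) p(2) sphere_map.simps by linarith
      moreover have "norm (stereo (Fin (poly q y)) - stereo Infty)
          \<le> norm (stereo (Fin (poly q y)) - stereo (Fin (poly p y))) + norm (stereo (Fin (poly p y)) - stereo Infty)"
        using norm_triangle_ineq[of "stereo (Fin (poly q y)) - stereo (Fin (poly p y))" "stereo (Fin (poly p y)) - stereo Infty"]
        by (simp del: stereo.simps)
      ultimately show False unfolding e_def by linarith
    qed
    then show "expands R g"
      unfolding expands_def q(2) using poly_expands[OF q(1), of R] R by auto
  qed
qed

lemma expands_mono: "expands R g \<Longrightarrow> R \<le> S \<Longrightarrow> expands S g"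
  unfolding expands_def by (meson order_trans)

lemma compact_expands:
  assumes "compact \<Gamma>" "\<Gamma> \<subseteq> Poly_plus"
  obtains R where "R \<ge> 1" "\<And>g. g \<in> \<Gamma> \<Longrightarrow> expands R g"
proof -
  have "\<forall>h. \<exists>R e. h \<in> \<Gamma> \<longrightarrow> R \<ge> 1 \<and> e > 0 \<and> (\<forall>g. dist g h < e \<longrightarrow> expands R g)"
    using locally_expands assms(2) by (metis subsetD)
  then obtain R e where Re: "\<And>h. h \<in> \<Gamma> \<Longrightarrow> R h \<ge> (1::real) \<and> e h > 0 \<and> (\<forall>g. dist g h < e h \<longrightarrow> expands (R h) g)"
    by metis
  have cover: "\<Gamma> \<subseteq> (\<Union>h\<in>\<Gamma>. ball h (e h))" using Re by auto
  obtain C where C: "C \<subseteq> \<Gamma>" "finite C" "\<Gamma> \<subseteq> (\<Union>h\<in>C. ball h (e h))"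
    by (rule compactE_image[OF assms(1) _ cover]) auto
  \<comment> \<open>The inserted 1 gives the lower bound on the radius and keeps \<open>Max\<close>
    meaningful for an empty cover.\<close>
  show thesis
  proof (rule that[of "Max (insert 1 (R ` C))"])
    fix g assume "g \<in> \<Gamma>"
    then obtain h where h: "h \<in> C" "dist g h < e h" using C(3) by (auto simp: dist_commute)
    then have "expands (R h) g" using Re C(1) by auto
    then show "expands (Max (insert 1 (R ` C))) g"
      by (rule expands_mono) (use C(2) h in auto)
  qed (use C in auto)
qed

section \<open>Path measures\<close>

text \<open>Generic in \<open>M\<close> and \<open>f\<close> so that one uniqueness argument serves
  twice: index paths with \<open>f\<close> the identity, and paths of pairs with
  \<open>f = snd\<close>.\<close>

definition labelled_cyl :: "'a measure \<Rightarrow> ('a \<Rightarrow> 'x) \<Rightarrow> 'x list \<Rightarrow> (nat \<Rightarrow> 'a set) \<Rightarrow> (nat \<Rightarrow> 'a) set" where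
  "labelled_cyl M f xs C =
     {\<omega> \<in> space (PiM UNIV (\<lambda>_::nat. M)). \<forall>k<length xs. f (\<omega> k) = xs ! k \<and> \<omega> k \<in> C k}"

lemma labelled_cyl_sets:
  fixes f :: "'a \<Rightarrow> 'x::finite"
  assumes [measurable]: "f \<in> measurable M (count_space UNIV)"
    and C: "\<And>k. k < length xs \<Longrightarrow> C k \<in> sets M"
  shows "labelled_cyl M f xs C \<in> sets (PiM UNIV (\<lambda>_::nat. M))"
proof -
  have "{\<omega> \<in> space (PiM UNIV (\<lambda>_::nat. M)). f (\<omega> k) = xs ! k \<and> \<omega> k \<in> C k} \<in> sets (PiM UNIV (\<lambda>_::nat. M))"
    if "k < length xs" for k
    using C[OF that] by measurable
  then have "{\<omega> \<in> space (PiM UNIV (\<lambda>_::nat. M)). \<forall>k\<in>{..<length xs}. f (\<omega> k) = xs ! k \<and> \<omega> k \<in> C k}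
      \<in> sets (PiM UNIV (\<lambda>_::nat. M))"
    by (rule sets.sets_Collect_finite_All) simp_all
  also have "{\<omega> \<in> space (PiM UNIV (\<lambda>_::nat. M)). \<forall>k\<in>{..<length xs}. f (\<omega> k) = xs ! k \<and> \<omega> k \<in> C k}
      = labelled_cyl M f xs C"
    unfolding labelled_cyl_def by auto
  finally show ?thesis .
qed

text \<open>There are finitely many labels, so a finite-dimensional rectangle splits into finitely
  many disjoint cylinders, one for each word. Hence it suffices to compare cylinders that prescribe
  a whole prefix of labels.\<close>

lemma measure_eqI_labelled_cyl:
  fixes f :: "'a \<Rightarrow> 'x::finite"
  assumes f: "f \<in> measurable M (count_space UNIV)"
    and N1: "sets N1 = sets (PiM UNIV (\<lambda>_::nat. M))" and N2: "sets N2 = sets (PiM UNIV (\<lambda>_::nat. M))"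
    and fin: "finite_measure N1"
    and eq: "\<And>xs C. (\<And>k. k < length xs \<Longrightarrow> C k \<in> sets M) \<Longrightarrow>
      emeasure N1 (labelled_cyl M f xs C) = emeasure N2 (labelled_cyl M f xs C)"
  shows "N1 = N2"
proof (rule measure_eqI_PiM_infinite[OF N1 N2 _ fin])
  fix A :: "nat \<Rightarrow> 'a set" and J :: "nat set"
  assume J: "finite J" "J \<subseteq> UNIV" and A: "\<And>i. i \<in> J \<Longrightarrow> A i \<in> sets M"
  from J(1) obtain n where n: "J \<subseteq> {..<n}" by (meson finite_nat_iff_bounded)
  \<comment> \<open>Coordinates below \<open>n\<close> that lie outside \<open>J\<close> are left
    unconstrained.\<close>
  define C where "C k = (if k \<in> J then A k else space M)" for k
  have C: "C k \<in> sets M" for k using A by (auto simp: C_def)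
  let ?W = "{xs :: 'x list. set xs \<subseteq> UNIV \<and> length xs = n}"
  have W: "finite ?W" by (rule finite_lists_length_eq) simp
  have split: "prod_emb UNIV (\<lambda>_. M) J (Pi\<^sub>E J A) = (\<Union>xs\<in>?W. labelled_cyl M f xs C)"
  proof (intro set_eqI iffI)
    fix \<omega> assume "\<omega> \<in> prod_emb UNIV (\<lambda>_. M) J (Pi\<^sub>E J A)"
    then have \<omega>: "\<omega> k \<in> space M" "k \<in> J \<Longrightarrow> \<omega> k \<in> A k" for k
      by (auto simp: prod_emb_iff PiE_iff)
    then have "\<omega> \<in> labelled_cyl M f (map (\<lambda>k. f (\<omega> k)) [0..<n]) C"
      by (auto simp: labelled_cyl_def space_PiM C_def)
    then show "\<omega> \<in> (\<Union>xs\<in>?W. labelled_cyl M f xs C)"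
      by (intro UN_I[of "map (\<lambda>k. f (\<omega> k)) [0..<n]"]) auto
  next
    fix \<omega> assume "\<omega> \<in> (\<Union>xs\<in>?W. labelled_cyl M f xs C)"
    then have \<omega>: "\<omega> k \<in> space M" "k < n \<Longrightarrow> \<omega> k \<in> C k" for k
      by (auto simp: labelled_cyl_def space_PiM)
    have "\<omega> k \<in> A k" if "k \<in> J" for k using \<omega>(2)[of k] n that by (auto simp: C_def)
    with \<omega>(1) show "\<omega> \<in> prod_emb UNIV (\<lambda>_. M) J (Pi\<^sub>E J A)"
      by (auto simp: prod_emb_iff PiE_iff)
  qed
  have disj: "disjoint_family_on (\<lambda>xs. labelled_cyl M f xs C) ?W"
    by (auto simp: disjoint_family_on_def labelled_cyl_def list_eq_iff_nth_eq)
  have sets: "labelled_cyl M f xs C \<in> sets (PiM UNIV (\<lambda>_::nat. M))" for xs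
    using f C by (rule labelled_cyl_sets)
  have "emeasure N1 (\<Union>xs\<in>?W. labelled_cyl M f xs C) = (\<Sum>xs\<in>?W. emeasure N1 (labelled_cyl M f xs C))"
    using sets by (intro sum_emeasure[symmetric] disj W) (auto simp: N1)
  also have "\<dots> = (\<Sum>xs\<in>?W. emeasure N2 (labelled_cyl M f xs C))"
    using C by (intro sum.cong refl eq) auto
  also have "\<dots> = emeasure N2 (\<Union>xs\<in>?W. labelled_cyl M f xs C)"
    using sets by (intro sum_emeasure disj W) (auto simp: N2)
  finally show "emeasure N1 (prod_emb UNIV (\<lambda>_. M) J (Pi\<^sub>E J A)) = emeasure N2 (prod_emb UNIV (\<lambda>_. M) J (Pi\<^sub>E J A))"
    unfolding split .
qed

abbreviation letters :: "(poly_map \<times> 'x) measure" where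
  "letters \<equiv> borel \<Otimes>\<^sub>M count_space UNIV"

definition poly_cyl :: "'x list \<Rightarrow> (nat \<Rightarrow> poly_map set) \<Rightarrow> (nat \<Rightarrow> poly_map \<times> 'x) set" where
  "poly_cyl xs A = {\<omega>. \<forall>k<length xs. snd (\<omega> k) = xs ! k \<and> fst (\<omega> k) \<in> A k}"

lemma space_PiM_letters [simp]: "space (PiM UNIV (\<lambda>_::nat. letters)) = UNIV"
  by (auto simp: space_PiM space_pair_measure)

text \<open>Once the label is prescribed, a set of pairs matters only through its slice at that
  label, which is a set of polynomial maps.\<close>

lemma labelled_cyl_letters:
  "labelled_cyl letters snd xs C = poly_cyl xs (\<lambda>k. (\<lambda>g. (g, xs ! k)) -` C k)"
  unfolding labelled_cyl_def poly_cyl_def space_PiM_letters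
  by (auto simp: prod_eq_iff) (metis prod.collapse)+

lemma poly_cyl_sets:
  fixes xs :: "'x::finite list"
  assumes "\<And>k. k < length xs \<Longrightarrow> A k \<in> sets borel"
  shows "poly_cyl xs A \<in> sets (PiM UNIV (\<lambda>_::nat. letters))"
proof -
  have "labelled_cyl letters snd xs (\<lambda>k. A k \<times> UNIV) \<in> sets (PiM UNIV (\<lambda>_::nat. letters))"
    using assms by (intro labelled_cyl_sets) auto
  then show ?thesis unfolding labelled_cyl_letters by (simp add: vimage_def)
qed

lemma measure_eqI_poly_cyl:
  fixes N1 N2 :: "(nat \<Rightarrow> poly_map \<times> 'x::finite) measure"
  assumes "sets N1 = sets (PiM UNIV (\<lambda>_::nat. letters))" "sets N2 = sets (PiM UNIV (\<lambda>_::nat. letters))"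
    and "finite_measure N1"
    and eq: "\<And>xs A. (\<And>k. k < length xs \<Longrightarrow> A k \<in> sets borel) \<Longrightarrow>
      emeasure N1 (poly_cyl xs A) = emeasure N2 (poly_cyl xs A)"
  shows "N1 = N2"
proof (rule measure_eqI_labelled_cyl[OF _ assms(1-3)])
  fix xs :: "'x list" and C :: "nat \<Rightarrow> (poly_map \<times> 'x) set"
  assume C: "\<And>k. k < length xs \<Longrightarrow> C k \<in> sets letters"
  show "emeasure N1 (labelled_cyl letters snd xs C) = emeasure N2 (labelled_cyl letters snd xs C)"
    unfolding labelled_cyl_letters
  proof (rule eq)
    fix k assume "k < length xs"
    from sets_Pair2[OF C[OF this]] show "(\<lambda>g. (g, xs ! k)) -` C k \<in> sets borel" .
  qed
qed simp

section \<open>The joint law of maps and indices\<close>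

locale finite_poly_rscc =
  fixes u :: "'w \<Rightarrow> 'x::{finite, discrete_topology} \<Rightarrow> 'w"
    and P :: "'w \<Rightarrow> 'x measure"
    and \<tau> :: "'x \<Rightarrow> poly_map measure"
  assumes sets_P: "sets (P v) = UNIV"
    and prob_P: "prob_space (P v)"
    and sets_tau: "sets (\<tau> x) = sets borel"
    and prob_tau: "prob_space (\<tau> x)"
begin

lemma space_P: "space (P v) = UNIV"
  using sets_eq_imp_space_eq[of "P v" "count_space UNIV"] sets_P by simp

lemma space_tau: "space (\<tau> x) = UNIV"
  using sets_eq_imp_space_eq[OF sets_tau] by simp

definition step :: "'w \<Rightarrow> (poly_map \<times> 'x) measure" where
  "step v = P v \<bind> (\<lambda>x. distr (\<tau> x) letters (\<lambda>g. (g, x)))"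

lemma Pair_measurable_tau: "(\<lambda>g. (g, x)) \<in> measurable (\<tau> x) letters"
  by (subst measurable_cong_sets[OF sets_tau refl]) (intro measurable_Pair measurable_ident measurable_const, simp_all)

lemma step_kernel: "(\<lambda>x. distr (\<tau> x) letters (\<lambda>g. (g, x))) \<in> measurable (P v) (subprob_algebra letters)"
proof -
  have "distr (\<tau> x) letters (\<lambda>g. (g, x)) \<in> space (subprob_algebra letters)" for x
    by (auto simp: space_subprob_algebra
        intro!: prob_space_imp_subprob_space prob_space.prob_space_distr prob_tau Pair_measurable_tau)
  then show ?thesis
    by (auto simp: measurable_def sets_P)
qed

lemma sets_step: "sets (step v) = sets letters"
  unfolding step_def by (rule sets_bind_measurable[OF step_kernel]) (simp add: space_P)

lemma prob_step: "prob_space (step v)"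
  unfolding step_def
  by (rule prob_space.prob_space_bind[OF prob_P _ step_kernel])
     (intro AE_I2 prob_space.prob_space_distr prob_tau Pair_measurable_tau)

lemma emeasure_step:
  assumes A: "A \<in> sets borel"
  shows "emeasure (step v) (A \<times> {x}) = emeasure (P v) {x} * emeasure (\<tau> x) A"
proof -
  have "emeasure (step v) (A \<times> {x}) = (\<integral>\<^sup>+y. emeasure (distr (\<tau> y) letters (\<lambda>g. (g, y))) (A \<times> {x}) \<partial>P v)"
    unfolding step_def using A by (intro emeasure_bind[OF _ step_kernel]) (auto simp: space_P)
  also have "\<dots> = (\<integral>\<^sup>+y. emeasure (\<tau> x) A * indicator {x} y \<partial>P v)"
  proof (rule nn_integral_cong)
    fix y
    have "(\<lambda>g. (g, y)) -` (A \<times> {x}) \<inter> space (\<tau> y) = (if y = x then A else {})"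
      by (auto simp: space_tau)
    then show "emeasure (distr (\<tau> y) letters (\<lambda>g. (g, y))) (A \<times> {x}) = emeasure (\<tau> x) A * indicator {x} y"
      using A by (subst emeasure_distr[OF Pair_measurable_tau]) auto
  qed
  also have "\<dots> = emeasure (P v) {x} * emeasure (\<tau> x) A"
    by (subst nn_integral_cmult_indicator) (auto simp: sets_P mult.commute)
  finally show ?thesis .
qed

definition kernel :: "'w \<Rightarrow> nat \<Rightarrow> (nat \<Rightarrow> poly_map \<times> 'x) \<Rightarrow> (poly_map \<times> 'x) measure" where
  "kernel w i \<omega> = step (foldl u w (map (\<lambda>j. snd (\<omega> j)) [0..<i]))"

text \<open>The past enters only through the word of its indices. Words form a countable discrete
  space, from which every map into the space of measures is measurable.\<close>

lemma kernel_measurable: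
  "kernel w i \<in> measurable (PiM {0..<i} (\<lambda>_. letters)) (subprob_algebra letters)"
proof -
  have "(\<lambda>\<omega>. map (\<lambda>j. snd (\<omega> j)) [0..<i]) \<in> measurable (PiM {0..<i} (\<lambda>_. letters)) (count_space (UNIV :: 'x list set))"
    (is "?f \<in> measurable ?M _")
  proof (subst measurable_count_space_eq2_countable, intro conjI ballI)
    fix xs :: "'x list"
    show "?f -` {xs} \<inter> space ?M \<in> sets ?M"
    proof (cases "length xs = i")
      case True
      have "{\<omega> \<in> space ?M. \<forall>k\<in>{0..<i}. snd (\<omega> k) = xs ! k} \<in> sets ?M"
        by (rule sets.sets_Collect_finite_All) measurable
      also have "{\<omega> \<in> space ?M. \<forall>k\<in>{0..<i}. snd (\<omega> k) = xs ! k} = ?f -` {xs} \<inter> space ?M"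
      proof -
        have "(map h [0..<i] = xs) = (\<forall>k\<in>{0..<i}. h k = xs ! k)" for h :: "nat \<Rightarrow> 'x"
          unfolding list_eq_iff_nth_eq using True by auto
        then show ?thesis by auto
      qed
      finally show ?thesis .
    next
      case False
      then have "?f -` {xs} \<inter> space ?M = {}" by auto
      then show ?thesis by simp
    qed
  qed auto
  moreover have "(\<lambda>xs. step (foldl u w xs)) \<in> measurable (count_space UNIV) (subprob_algebra letters)"
    by (auto simp: space_subprob_algebra sets_step intro!: prob_space_imp_subprob_space prob_step)
  ultimately show ?thesis
    unfolding kernel_def[abs_def] by (rule measurable_compose)
qed

lemma joint_measure_exists:
  obtains N :: "(nat \<Rightarrow> poly_map \<times> 'x) measure"
  where "sets N = sets (PiM UNIV (\<lambda>_::nat. letters))"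
    and "\<And>xs A. (\<And>k. k < length xs \<Longrightarrow> A k \<in> sets borel) \<Longrightarrow> emeasure N (poly_cyl xs A) =
      (\<Prod>k<length xs. emeasure (P (foldl u w (take k xs))) {xs ! k} * emeasure (\<tau> (xs ! k)) (A k))"
proof -
  let ?M = "\<lambda>_::nat. letters :: (poly_map \<times> 'x) measure"
  interpret IT: Ionescu_Tulcea "kernel w" ?M
    by (rule Ionescu_Tulcea.intro, rule kernel_measurable, unfold kernel_def, rule prob_step)
  \<comment> \<open>The empty past: a product over no coordinates has the \<open>undefined\<close>
    function as its only point.\<close>
  let ?z = "\<lambda>_::nat. undefined :: poly_map \<times> 'x"
  have C: "emeasure (IT.C 0 n ?z) (PiE {0..<n} (\<lambda>k. A k \<times> {xs ! k})) =
      (\<Prod>k<n. emeasure (P (foldl u w (take k xs))) {xs ! k} * emeasure (\<tau> (xs ! k)) (A k))"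
    if "n \<le> length xs" and A: "\<And>k. k < n \<Longrightarrow> A k \<in> sets borel" for n xs A
    using that
  proof (induction n)
    case 0
    show ?case by (simp add: space_PiM sets_PiM_empty)
  next
    case (Suc n)
    let ?R = "\<lambda>n. PiE {0..<n} (\<lambda>k. A k \<times> {xs ! k})"
    let ?c = "emeasure (P (foldl u w (take n xs))) {xs ! n} * emeasure (\<tau> (xs ! n)) (A n)"
    have R: "?R (Suc n) \<in> sets (PiM {0..<Suc n} ?M)" and Rn: "?R n \<in> sets (PiM {0..<n} ?M)"
      using Suc.prems(2) by (auto intro!: sets_PiM_I_finite pair_measureI)
    have z: "?z \<in> space (PiM {0..<0} ?M)" by (simp add: space_PiM)
    have ne: "space (IT.C 0 n ?z) \<noteq> {}"
      using IT.prob_space_C[OF z] by (rule prob_space.not_empty)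
    have eP: "IT.eP n \<in> measurable (IT.C 0 n ?z) (subprob_algebra (PiM {0..<Suc n} ?M))"
      unfolding measurable_cong_sets[OF IT.sets_C[OF z, of n, unfolded add_0] refl] by (rule IT.measurable_eP)
    have "emeasure (IT.C 0 (Suc n) ?z) (?R (Suc n)) = (\<integral>\<^sup>+\<omega>. emeasure (IT.eP n \<omega>) (?R (Suc n)) \<partial>IT.C 0 n ?z)"
      using emeasure_bind[OF ne eP R] by simp
    also have "\<dots> = (\<integral>\<^sup>+\<omega>. ?c * indicator (?R n) \<omega> \<partial>IT.C 0 n ?z)"
    proof (rule nn_integral_cong)
      fix \<omega> assume "\<omega> \<in> space (IT.C 0 n ?z)"
      then have \<omega>: "\<omega> \<in> space (PiM {0..<n} ?M)" using IT.space_C[OF z, of n] by simp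
      have "emeasure (IT.eP n \<omega>) (?R (Suc n)) =
          emeasure (kernel w n \<omega>) (fun_upd \<omega> n -` ?R (Suc n) \<inter> space letters)"
        by (rule IT.emeasure_eP[OF \<omega> R])
      also have "\<dots> = ?c * indicator (?R n) \<omega>"
      proof (cases "\<omega> \<in> ?R n")
        case True
        \<comment> \<open>On the rectangle the indices spell a prefix of \<open>xs\<close>, so the
          kernel is constant there and the integral factorises.\<close>
        then have "map (\<lambda>j. snd (\<omega> j)) [0..<n] = take n xs"
          using Suc.prems(1) by (auto simp: list_eq_iff_nth_eq PiE_iff mem_Times_iff)
        then have "kernel w n \<omega> = step (foldl u w (take n xs))" by (simp add: kernel_def)
        moreover have "fun_upd \<omega> n -` ?R (Suc n) \<inter> space letters = A n \<times> {xs ! n}"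
          using True by (auto simp: PiE_iff space_pair_measure extensional_def atLeastLessThanSuc split: if_splits)
        ultimately show ?thesis using True Suc.prems(2) by (simp add: emeasure_step)
      next
        case False
        \<comment> \<open>Updating coordinate \<open>n\<close> leaves the earlier ones alone, so a
          past outside the rectangle has no extension inside.\<close>
        have "fun_upd \<omega> n -` ?R (Suc n) = {}"
        proof (rule ccontr)
          assume "fun_upd \<omega> n -` ?R (Suc n) \<noteq> {}"
          then obtain x where x: "fun_upd \<omega> n x \<in> ?R (Suc n)" by blast
          have "\<omega> k \<in> A k \<times> {xs ! k}" if "k < n" for k
            using PiE_mem[OF x, of k] that by simp
          moreover have "\<omega> \<in> extensional {0..<n}" using \<omega> by (simp add: space_PiM PiE_iff)
          ultimately show False using False by (simp add: PiE_iff)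
        qed
        then show ?thesis using False by simp
      qed
      finally show "emeasure (IT.eP n \<omega>) (?R (Suc n)) = ?c * indicator (?R n) \<omega>" .
    qed
    also have "\<dots> = ?c * emeasure (IT.C 0 n ?z) (?R n)"
      using Rn IT.sets_C[OF z, of n] by (intro nn_integral_cmult_indicator) simp
    also have "\<dots> = ?c * (\<Prod>k<n. emeasure (P (foldl u w (take k xs))) {xs ! k} * emeasure (\<tau> (xs ! k)) (A k))"
      using Suc by simp
    finally show ?case by (simp add: mult.commute)
  qed
  show thesis
  proof (rule that[of IT.PF.lim])
    show "sets IT.PF.lim = sets (PiM UNIV ?M)" by simp
    fix xs :: "'x list" and A :: "nat \<Rightarrow> poly_map set"
    assume A: "\<And>k. k < length xs \<Longrightarrow> A k \<in> sets borel"
    let ?n = "length xs"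
    let ?R = "PiE {0..<?n} (\<lambda>k. A k \<times> {xs ! k})"
    have R: "?R \<in> sets (PiM {0..<?n} ?M)"
      using A by (auto intro!: sets_PiM_I_finite pair_measureI)
    have "poly_cyl xs A = prod_emb UNIV ?M {0..<?n} ?R"
      by (auto simp: poly_cyl_def prod_emb_iff PiE_iff mem_Times_iff space_pair_measure)
    then have "emeasure IT.PF.lim (poly_cyl xs A) = emeasure (IT.CI {0..<?n}) ?R"
      using IT.lim[OF _ R] by simp
    also have "\<dots> = emeasure (IT.C 0 ?n ?z) ?R"
      using IT.emeasure_CI[OF subset_refl R] prod_emb_id[OF sets.sets_into_space[OF R, unfolded space_PiM]]
      by simp
    also have "\<dots> = (\<Prod>k<?n. emeasure (P (foldl u w (take k xs))) {xs ! k} * emeasure (\<tau> (xs ! k)) (A k))"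
      using A by (intro C) auto
    finally show "emeasure IT.PF.lim (poly_cyl xs A) =
      (\<Prod>k<?n. emeasure (P (foldl u w (take k xs))) {xs ! k} * emeasure (\<tau> (xs ! k)) (A k))" .
  qed
qed

end

section \<open>Supports of measures and the cylinder topology\<close>

lemma map_upt_eq_iff: "map f [0..<n] = xs \<longleftrightarrow> length xs = n \<and> (\<forall>k<n. f k = xs ! k)"
  unfolding list_eq_iff_nth_eq by auto

text \<open>Each neighbourhood contains a basic one, so null basic sets already exhaust the
  complement. When the basis is countable, the complement is thereby a null set.\<close>

lemma msupp_eq_compl:
  assumes "topological_basis B" "B \<subseteq> sets M" "\<And>U. open U \<Longrightarrow> U \<in> sets M"
  shows "msupp M = - \<Union>{b \<in> B. emeasure M b = 0}"
proof (intro set_eqI iffI)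
  fix x assume "x \<in> msupp M"
  then show "x \<in> - \<Union>{b \<in> B. emeasure M b = 0}"
    using topological_basis_open[OF assms(1)] by (force simp: msupp_def)
next
  fix x assume x: "x \<in> - \<Union>{b \<in> B. emeasure M b = 0}"
  show "x \<in> msupp M" unfolding msupp_def
  proof (intro CollectI allI impI)
    fix U assume U: "open U" "x \<in> U"
    then obtain b where b: "b \<in> B" "x \<in> b" "b \<subseteq> U" using topological_basisE[OF assms(1)] by metis
    then have "emeasure M b > 0" using x by (auto simp: zero_less_iff_neq_zero)
    also have "emeasure M b \<le> emeasure M U" using b assms U by (intro emeasure_mono) auto
    finally show "emeasure M U > 0" .
  qed
qed

lemma
  fixes M :: "'a::second_countable_topology measure"
  assumes M: "sets M = sets borel"
  shows msupp_borel: "msupp M \<in> sets borel" and AE_msupp: "AE x in M. x \<in> msupp M"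
proof -
  obtain B :: "'a set set" where B: "countable B" "topological_basis B" using ex_countable_basis by blast
  have B_sets: "B \<subseteq> sets M" using topological_basis_open[OF B(2)] M by auto
  have eq: "msupp M = - \<Union>{b \<in> B. emeasure M b = 0}"
    by (rule msupp_eq_compl[OF B(2) B_sets]) (simp add: M)
  have null: "\<Union>{b \<in> B. emeasure M b = 0} \<in> null_sets M"
    using B(1) B_sets null_sets_UN'[of "{b \<in> B. emeasure M b = 0}" "\<lambda>b. b" M] by (auto simp: null_sets_def)
  then show "msupp M \<in> sets borel" unfolding eq M[symmetric] using sets_eq_imp_space_eq[OF M]
      sets.compl_sets[OF null_setsD2[OF null]] by (simp add: Compl_eq_Diff_UNIV)
  show "AE x in M. x \<in> msupp M"
    using AE_not_in[OF null] unfolding eq by simp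
qed

text \<open>A basic neighbourhood in the product constrains finitely many coordinates, and over a
  discrete space a long enough prefix fixes all of them. This reduces supports of path measures to
  statements about words.\<close>

lemma topological_basis_cyl: "topological_basis (range (cyl :: 'x::discrete_topology list \<Rightarrow> _))"
proof (rule topological_basisI)
  fix U :: "(nat \<Rightarrow> 'x) set" and x assume U: "open U" "x \<in> U"
  then have "openin (product_topology (\<lambda>i. euclidean) UNIV) U" by (simp add: open_fun_def)
  from product_topology_open_contains_basis[OF this U(2)] obtain X
    where X: "x \<in> PiE UNIV X" "finite {i. X i \<noteq> UNIV}" "PiE UNIV X \<subseteq> U" by auto
  obtain n where n: "{i. X i \<noteq> UNIV} \<subseteq> {..<n}" using X(2) by (meson finite_nat_iff_bounded)
  let ?c = "cyl (map x [0..<n])"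
  have "?c \<subseteq> PiE UNIV X"
  proof
    fix y assume y: "y \<in> ?c"
    have "y i \<in> X i" for i
    proof (cases "i < n")
      case True
      then have "y i = x i" using y by (simp add: cyl_def)
      then show ?thesis using X(1) by auto
    qed (use n in auto)
    then show "y \<in> PiE UNIV X" by auto
  qed
  then show "\<exists>b\<in>range cyl. x \<in> b \<and> b \<subseteq> U"
    using X(3) by (intro bexI[of _ ?c] conjI rangeI) (auto simp: cyl_def)
next
  fix b :: "(nat \<Rightarrow> 'x) set" assume "b \<in> range cyl"
  then obtain xs where "b = cyl xs" by blast
  moreover have "open {\<omega> :: nat \<Rightarrow> 'x. \<forall>i\<in>{..<length xs}. \<omega> i \<in> {xs ! i}}"
    by (rule product_topology_basis'[where x = "\<lambda>i. i"]) (simp_all add: Topological_Spaces.open_discrete)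
  moreover have "cyl xs = {\<omega>. \<forall>i\<in>{..<length xs}. \<omega> i \<in> {xs ! i}}" by (auto simp: cyl_def)
  ultimately show "open b" by simp
qed

lemma cyl_sets:
  fixes xs :: "'x::finite list"
  shows "cyl xs \<in> sets (PiM UNIV (\<lambda>_::nat. count_space UNIV))"
proof -
  have "labelled_cyl (count_space UNIV) (\<lambda>x. x) xs (\<lambda>_. UNIV) \<in> sets (PiM UNIV (\<lambda>_::nat. count_space UNIV))"
    by (rule labelled_cyl_sets) auto
  then show ?thesis by (simp add: labelled_cyl_def cyl_def space_PiM)
qed

section \<open>Identification of the path measures\<close>

context finite_poly_rscc
begin

text \<open>The formula on cylinders determines the measure by \<open>measure_eqI_poly_cyl\<close>,
  so the choice operator has a single candidate.\<close>

definition joint :: "'w \<Rightarrow> (nat \<Rightarrow> poly_map \<times> 'x) measure" where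
  "joint w = (SOME N. sets N = sets (PiM UNIV (\<lambda>_::nat. letters)) \<and>
     (\<forall>xs A. (\<forall>k<length xs. A k \<in> sets borel) \<longrightarrow> emeasure N (poly_cyl xs A) =
      (\<Prod>k<length xs. emeasure (P (foldl u w (take k xs))) {xs ! k} * emeasure (\<tau> (xs ! k)) (A k))))"

lemma
  shows sets_joint [measurable_cong]: "sets (joint w) = sets (PiM UNIV (\<lambda>_::nat. letters))"
    and emeasure_joint: "(\<And>k. k < length xs \<Longrightarrow> A k \<in> sets borel) \<Longrightarrow> emeasure (joint w) (poly_cyl xs A) =
      (\<Prod>k<length xs. emeasure (P (foldl u w (take k xs))) {xs ! k} * emeasure (\<tau> (xs ! k)) (A k))"
proof -
  have "\<exists>N. sets N = sets (PiM UNIV (\<lambda>_::nat. letters)) \<and>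
     (\<forall>xs A. (\<forall>k<length xs. A k \<in> sets borel) \<longrightarrow> emeasure N (poly_cyl xs A) =
      (\<Prod>k<length xs. emeasure (P (foldl u w (take k xs))) {xs ! k} * emeasure (\<tau> (xs ! k)) (A k)))"
    by (rule joint_measure_exists[of w]) blast
  from someI_ex[OF this] show "sets (joint w) = sets (PiM UNIV (\<lambda>_::nat. letters))"
    and "(\<And>k. k < length xs \<Longrightarrow> A k \<in> sets borel) \<Longrightarrow> emeasure (joint w) (poly_cyl xs A) =
      (\<Prod>k<length xs. emeasure (P (foldl u w (take k xs))) {xs ! k} * emeasure (\<tau> (xs ! k)) (A k))"
    unfolding joint_def[symmetric] by blast+
qed

lemma space_joint [simp]: "space (joint w) = UNIV"
  using sets_eq_imp_space_eq[OF sets_joint] by simp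

lemma prob_joint: "prob_space (joint w)"
proof
  have "poly_cyl [] (\<lambda>_. UNIV) = (UNIV :: (nat \<Rightarrow> poly_map \<times> 'x) set)" by (simp add: poly_cyl_def)
  then show "emeasure (joint w) (space (joint w)) = 1"
    using emeasure_joint[of "[]" "\<lambda>_. UNIV" w] by simp
qed

definition word_prob :: "'w \<Rightarrow> 'x list \<Rightarrow> real" where
  "word_prob w xs = (\<Prod>i<length xs. measure (P (foldl u w (take i xs))) {xs ! i})"

lemma word_prob_nonneg: "word_prob w xs \<ge> 0"
  unfolding word_prob_def by (intro prod_nonneg) auto

lemma emeasure_joint_eq:
  assumes "\<And>k. k < length xs \<Longrightarrow> A k \<in> sets borel"
  shows "emeasure (joint w) (poly_cyl xs A) = ennreal (word_prob w xs * (\<Prod>k<length xs. measure (\<tau> (xs ! k)) (A k)))"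
proof -
  have "emeasure (joint w) (poly_cyl xs A) =
      (\<Prod>k<length xs. emeasure (P (foldl u w (take k xs))) {xs ! k} * emeasure (\<tau> (xs ! k)) (A k))"
    using assms by (rule emeasure_joint)
  also have "\<dots> = (\<Prod>k<length xs. ennreal (measure (P (foldl u w (take k xs))) {xs ! k} * measure (\<tau> (xs ! k)) (A k)))"
    by (simp add: ennreal_mult finite_measure.emeasure_eq_measure prob_space.finite_measure prob_P prob_tau)
  also have "\<dots> = ennreal (word_prob w xs * (\<Prod>k<length xs. measure (\<tau> (xs ! k)) (A k)))"
    unfolding word_prob_def prod.distrib[symmetric] by (rule prod_ennreal) simp
  finally show ?thesis .
qed

lemma measure_joint:
  assumes "\<And>k. k < length xs \<Longrightarrow> A k \<in> sets borel"
  shows "measure (joint w) (poly_cyl xs A) = word_prob w xs * (\<Prod>k<length xs. measure (\<tau> (xs ! k)) (A k))"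
  using assms by (simp add: measure_def[of "joint w"] emeasure_joint_eq word_prob_nonneg prod_nonneg)

lemma labels_measurable:
  "(\<lambda>\<omega> n. snd (\<omega> n)) \<in> measurable (joint w) (PiM UNIV (\<lambda>_::nat. count_space UNIV))"
  by (rule measurable_PiM_single') (auto simp: space_PiM)

definition path :: "'w \<Rightarrow> (nat \<Rightarrow> 'x) measure" where
  "path w = distr (joint w) (PiM UNIV (\<lambda>_::nat. count_space UNIV)) (\<lambda>\<omega> n. snd (\<omega> n))"

lemma measure_path: "measure (path w) (cyl xs) = word_prob w xs"
proof -
  have "(\<lambda>\<omega> n. snd (\<omega> n)) -` cyl xs \<inter> space (joint w) = poly_cyl xs (\<lambda>_. UNIV)"
    by (auto simp: cyl_def poly_cyl_def)
  moreover have "measure (\<tau> x) UNIV = 1" for x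
    using prob_space.prob_space[OF prob_tau, of x] by (simp add: space_tau)
  ultimately show ?thesis
    unfolding path_def by (subst measure_distr[OF labels_measurable cyl_sets]) (simp add: measure_joint)
qed

lemma prob_path: "prob_space (path w)"
  unfolding path_def by (rule prob_space.prob_space_distr[OF prob_joint labels_measurable])

lemma path_measure_eq: "path_measure u P w = path w"
  unfolding path_measure_def
proof (rule the_equality)
  show "sets (path w) = sets (PiM UNIV (\<lambda>_::nat. count_space UNIV)) \<and> prob_space (path w) \<and>
    (\<forall>xs. measure (path w) (cyl xs) = (\<Prod>i<length xs. measure (P (foldl u w (take i xs))) {xs ! i}))"
    by (simp add: prob_path measure_path word_prob_def) (simp add: path_def)
next
  fix M :: "(nat \<Rightarrow> 'x) measure"
  assume M: "sets M = sets (PiM UNIV (\<lambda>_::nat. count_space UNIV)) \<and> prob_space M \<and>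
    (\<forall>xs. measure M (cyl xs) = (\<Prod>i<length xs. measure (P (foldl u w (take i xs))) {xs ! i}))"
  then have fin: "finite_measure M" by (auto intro: prob_space.finite_measure)
  show "M = path w"
  proof (rule measure_eqI_labelled_cyl[where f = "\<lambda>x. x", OF _ _ _ fin])
    fix xs :: "'x list" and C :: "nat \<Rightarrow> 'x set"
    have "emeasure M (cyl xs) = emeasure (path w) (cyl xs)"
      using M by (simp add: finite_measure.emeasure_eq_measure[OF fin] measure_path word_prob_def
          finite_measure.emeasure_eq_measure[OF prob_space.finite_measure[OF prob_path]])
    \<comment> \<open>Here the label is the letter itself, so the sets \<open>C k\<close> either
      admit the whole word or exclude it.\<close>
    moreover have "labelled_cyl (count_space UNIV) (\<lambda>x. x) xs C = (if \<forall>k<length xs. xs ! k \<in> C k then cyl xs else {})"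
      by (auto simp: labelled_cyl_def cyl_def space_PiM)
    ultimately show "emeasure M (labelled_cyl (count_space UNIV) (\<lambda>x. x) xs C)
        = emeasure (path w) (labelled_cyl (count_space UNIV) (\<lambda>x. x) xs C)" by simp
  qed (use M in \<open>auto simp: path_def\<close>)
qed

lemma adm_words_iff: "xs \<in> adm_words u P w n \<longleftrightarrow> length xs = n \<and> word_prob w xs > 0"
  by (simp add: adm_words_def path_measure_eq measure_path)

text \<open>Since cylinders form a basis, a path lies in the support as soon as none of its prefixes
  is null.\<close>

lemma msupp_path_iff: "\<omega> \<in> msupp (path_measure u P w) \<longleftrightarrow> (\<forall>n. word_prob w (map \<omega> [0..<n]) > 0)"
proof -
  have fin: "finite_measure (path w)" by (rule prob_space.finite_measure[OF prob_path])
  have sets: "sets (path w) = sets (PiM UNIV (\<lambda>_::nat. count_space UNIV))" by (simp add: path_def)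
  \<comment> \<open>Every open set is a union of cylinders, of which there are only countably
    many.\<close>
  have "U \<in> sets (path w)" if "open U" for U
  proof -
    obtain B' where "B' \<subseteq> range cyl" "\<Union>B' = U"
      using topological_basis_cyl \<open>open U\<close> unfolding topological_basis_def by blast
    moreover have "countable (range (cyl :: 'x list \<Rightarrow> _))" by (intro countable_image) auto
    ultimately have "countable B'" "B' \<subseteq> sets (path w)" unfolding sets
      using cyl_sets by (auto intro: countable_subset)
    then show ?thesis unfolding \<open>\<Union>B' = U\<close>[symmetric] by (intro sets.countable_Union)
  qed
  then have "msupp (path w) = - \<Union>{b \<in> range cyl. emeasure (path w) b = 0}"
    using cyl_sets sets by (intro msupp_eq_compl[OF topological_basis_cyl]) auto
  moreover have "emeasure (path w) (cyl xs) = 0 \<longleftrightarrow> \<not> word_prob w xs > 0" for xs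
    using word_prob_nonneg[of w xs]
    by (simp add: finite_measure.emeasure_eq_measure[OF fin] measure_path ennreal_eq_0_iff not_less)
  moreover have "\<omega> \<in> cyl xs \<longleftrightarrow> (\<exists>n. map \<omega> [0..<n] = xs)" for xs
    unfolding map_upt_eq_iff by (auto simp: cyl_def)
  ultimately show ?thesis
    unfolding path_measure_eq by auto
qed

lemma Xi_iff:
  "\<omega> \<in> Xi u P \<tau> w \<longleftrightarrow> (\<forall>n. word_prob w (map (\<lambda>k. snd (\<omega> k)) [0..<n]) > 0) \<and>
     (\<forall>n. fst (\<omega> n) \<in> msupp (\<tau> (snd (\<omega> n))))"
  by (simp add: Xi_def msupp_path_iff)

lemma Gamma_borel: "msupp (\<tau> x) \<in> sets borel"
  by (rule msupp_borel[OF sets_tau])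

lemma measure_tau_Int: "A \<in> sets borel \<Longrightarrow> measure (\<tau> x) (A \<inter> msupp (\<tau> x)) = measure (\<tau> x) A"
  using AE_msupp[OF sets_tau, of x] prob_space.finite_measure[OF prob_tau, of x] Gamma_borel[of x]
  by (intro finite_measure.finite_measure_eq_AE) (auto simp: sets_tau)

lemma Xi_sets: "Xi u P \<tau> w \<in> sets (PiM UNIV (\<lambda>_::nat. letters))" (is "_ \<in> sets ?L")
  and AE_Xi: "AE \<omega> in joint w. \<omega> \<in> Xi u P \<tau> w"
proof -
  let ?W = "\<lambda>n. {xs :: 'x list. set xs \<subseteq> UNIV \<and> length xs = n}"
  have W: "finite (?W n)" for n by (rule finite_lists_length_eq) simp
  \<comment> \<open>A path fails to lie in \<open>Xi\<close> at some finite time, through an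
    inadmissible prefix or a map off its support. The second case needs words of length
    \<open>Suc n\<close>, because the index at position \<open>n\<close> decides which support is
    meant.\<close>
  let ?bad1 = "\<lambda>n. \<Union>xs\<in>{xs\<in>?W n. \<not> word_prob w xs > 0}. poly_cyl xs (\<lambda>_. UNIV)"
  let ?bad2 = "\<lambda>n. \<Union>xs\<in>?W (Suc n). poly_cyl xs (\<lambda>k. if k = n then - msupp (\<tau> (xs ! n)) else UNIV)"
  have eq: "Xi u P \<tau> w = UNIV - ((\<Union>n. ?bad1 n) \<union> (\<Union>n. ?bad2 n))"
  proof (intro set_eqI)
    fix \<omega>
    have 1: "\<omega> \<in> ?bad1 n \<longleftrightarrow> \<not> word_prob w (map (\<lambda>k. snd (\<omega> k)) [0..<n]) > 0" for n
    proof -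
      have "\<omega> \<in> poly_cyl xs (\<lambda>_. UNIV) \<longleftrightarrow> map (\<lambda>k. snd (\<omega> k)) [0..<n] = xs" if "length xs = n" for xs
        using that by (auto simp: poly_cyl_def map_upt_eq_iff)
      then show ?thesis by auto
    qed
    have 2: "\<omega> \<in> ?bad2 n \<longleftrightarrow> fst (\<omega> n) \<notin> msupp (\<tau> (snd (\<omega> n)))" for n
    proof
      assume "fst (\<omega> n) \<notin> msupp (\<tau> (snd (\<omega> n)))"
      then show "\<omega> \<in> ?bad2 n"
        by (intro UN_I[of "map (\<lambda>k. snd (\<omega> k)) [0..<Suc n]"]) (auto simp: poly_cyl_def simp del: upt_Suc)
    qed (auto simp: poly_cyl_def)
    show "\<omega> \<in> Xi u P \<tau> w \<longleftrightarrow> \<omega> \<in> UNIV - ((\<Union>n. ?bad1 n) \<union> (\<Union>n. ?bad2 n))"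
      unfolding Xi_iff Diff_iff Un_iff UN_iff[of _ _ UNIV] 1 2 by simp
  qed
  have null: "poly_cyl xs A \<in> null_sets (joint w)"
    if "\<And>k. k < length xs \<Longrightarrow> A k \<in> sets borel"
      and "word_prob w xs * (\<Prod>k<length xs. measure (\<tau> (xs ! k)) (A k)) = 0" for xs A
    using emeasure_joint_eq[of xs A w, OF that(1)] that poly_cyl_sets[of xs A, OF that(1)]
    by (auto simp: null_sets_def sets_joint)
  have "?bad1 n \<in> null_sets (joint w)" for n
    using W word_prob_nonneg[of w] by (intro null_sets_UN' null countable_finite) (auto simp: not_less antisym)
  moreover have "?bad2 n \<in> null_sets (joint w)" for n
  proof (intro null_sets_UN' countable_finite W null)
    fix xs k assume "xs \<in> ?W (Suc n)"
    then have n: "n < length xs" by simp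
    have "measure (\<tau> (xs ! n)) (- msupp (\<tau> (xs ! n)) \<inter> msupp (\<tau> (xs ! n))) = measure (\<tau> (xs ! n)) (- msupp (\<tau> (xs ! n)))"
      using Gamma_borel by (intro measure_tau_Int) auto
    then have "measure (\<tau> (xs ! n)) (- msupp (\<tau> (xs ! n))) = 0" by simp
    with n show "word_prob w xs * (\<Prod>k<length xs. measure (\<tau> (xs ! k)) (if k = n then - msupp (\<tau> (xs ! n)) else UNIV)) = 0"
      by (auto simp: prod_zero_iff intro!: disjI2 bexI[of _ n])
  qed (use Gamma_borel in auto)
  ultimately have N: "(\<Union>n. ?bad1 n) \<union> (\<Union>n. ?bad2 n) \<in> null_sets (joint w)"
    by (intro null_sets.Un null_sets_UN)
  then show "Xi u P \<tau> w \<in> sets ?L"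
    unfolding eq sets_joint[symmetric, of w] space_joint[symmetric, of w] by blast
  show "AE \<omega> in joint w. \<omega> \<in> Xi u P \<tau> w"
    using AE_not_in[OF N] unfolding eq by simp
qed

lemma Xi_cyl: "{\<omega> \<in> Xi u P \<tau> w. \<forall>k<length xs. snd (\<omega> k) = xs ! k \<and> fst (\<omega> k) \<in> A k} = poly_cyl xs A \<inter> Xi u P \<tau> w"
  by (auto simp: poly_cyl_def)

lemma measure_joint_Int_Xi:
  assumes "E \<in> sets (PiM UNIV (\<lambda>_::nat. letters))"
  shows "measure (joint w) (E \<inter> Xi u P \<tau> w) = measure (joint w) E"
  using AE_Xi[of w] prob_space.finite_measure[OF prob_joint, of w] Xi_sets assms
  by (intro finite_measure.finite_measure_eq_AE) (auto simp: sets_joint)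

lemma Xi_in_joint: "Xi u P \<tau> w \<inter> space (joint w) \<in> sets (joint w)"
  using Xi_sets[of w] by (simp add: sets_joint)

text \<open>For uniqueness, a candidate is pushed forward to the full sequence space, where
  cylinders determine a measure. The restricted form of the characterising formula loses nothing:
  cylinders of inadmissible words miss \<open>Xi\<close>, and on \<open>Xi\<close> each
  \<open>A k\<close> may be intersected with the support.\<close>

lemma tau_path_eq: "tau_path u P \<tau> w = restrict_space (joint w) (Xi u P \<tau> w)"
  unfolding tau_path_def
proof (rule the_equality, intro conjI allI ballI impI)
  let ?X = "Xi u P \<tau> w" let ?R = "restrict_space (joint w) ?X"
  show "space ?R = ?X" by (simp add: space_restrict_space)
  show "sets ?R = sets (restrict_space (PiM UNIV (\<lambda>_::nat. letters)) ?X)"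
    by (rule sets_restrict_space_cong[OF sets_joint])
  have "emeasure (joint w) ?X = 1"
    using AE_Xi prob_space.emeasure_eq_1_AE[OF prob_joint, of ?X w] Xi_sets by (simp add: sets_joint)
  then show "prob_space ?R"
    by (intro prob_space_restrict_space) (use Xi_sets in \<open>auto simp: sets_joint\<close>)
  fix n xs and A :: "nat \<Rightarrow> poly_map set"
  assume xs: "xs \<in> adm_words u P w n" and A: "\<forall>k<n. A k \<in> sets borel \<and> A k \<subseteq> msupp (\<tau> (xs ! k))"
  then have n: "length xs = n" by (simp add: adm_words_iff)
  have "measure ?R (poly_cyl xs A \<inter> ?X) = measure (joint w) (poly_cyl xs A)"
    using measure_joint_Int_Xi[OF poly_cyl_sets, of xs A w] A n
    by (subst measure_restrict_space[OF Xi_in_joint]) auto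
  also have "\<dots> = word_prob w xs * (\<Prod>k<n. measure (\<tau> (xs ! k)) (A k))"
    using A n by (subst measure_joint) auto
  finally show "measure ?R {\<omega> \<in> ?X. \<forall>k<n. snd (\<omega> k) = xs ! k \<and> fst (\<omega> k) \<in> A k} =
      measure (path_measure u P w) (cyl xs) * (\<Prod>k<n. measure (\<tau> (xs ! k)) (A k))"
    unfolding n[symmetric] Xi_cyl path_measure_eq measure_path by simp
next
  let ?X = "Xi u P \<tau> w" let ?L = "PiM UNIV (\<lambda>_::nat. letters) :: (nat \<Rightarrow> poly_map \<times> 'x) measure"
  fix M :: "(nat \<Rightarrow> poly_map \<times> 'x) measure"
  assume "space M = ?X \<and> sets M = sets (restrict_space ?L ?X) \<and> prob_space M \<and>
    (\<forall>n. \<forall>xs\<in>adm_words u P w n. \<forall>A. (\<forall>k<n. A k \<in> sets borel \<and> A k \<subseteq> msupp (\<tau> (xs ! k))) \<longrightarrow>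
      measure M {\<omega> \<in> ?X. \<forall>k<n. snd (\<omega> k) = xs ! k \<and> fst (\<omega> k) \<in> A k} =
        measure (path_measure u P w) (cyl xs) * (\<Prod>k<n. measure (\<tau> (xs ! k)) (A k)))"
  then have spM: "space M = ?X" and setsM: "sets M = sets (restrict_space ?L ?X)" and probM: "prob_space M"
    and M: "\<And>xs A. word_prob w xs > 0 \<Longrightarrow> (\<And>k. k < length xs \<Longrightarrow> A k \<in> sets borel \<and> A k \<subseteq> msupp (\<tau> (xs ! k))) \<Longrightarrow>
      measure M (poly_cyl xs A \<inter> ?X) = word_prob w xs * (\<Prod>k<length xs. measure (\<tau> (xs ! k)) (A k))"
    by (auto simp: adm_words_iff path_measure_eq measure_path simp flip: Xi_cyl)
  have fin: "finite_measure M" by (rule prob_space.finite_measure[OF probM])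
  have id: "(\<lambda>\<omega>. \<omega>) \<in> measurable M ?L"
    unfolding measurable_cong_sets[OF setsM refl] by (rule measurable_restrict_space1) simp
  define N where "N = distr M ?L (\<lambda>\<omega>. \<omega>)"
  have N_eq: "emeasure N E = emeasure M (E \<inter> ?X)" if "E \<in> sets ?L" for E
    unfolding N_def using that by (simp add: emeasure_distr[OF id] spM)
  have "N = joint w"
  proof (rule measure_eqI_poly_cyl)
    show "finite_measure N" unfolding N_def
      using prob_space.prob_space_distr[OF probM id] by (rule prob_space.finite_measure)
    fix xs :: "'x list" and A :: "nat \<Rightarrow> poly_map set"
    assume A: "\<And>k. k < length xs \<Longrightarrow> A k \<in> sets borel"
    have "measure M (poly_cyl xs A \<inter> ?X) = word_prob w xs * (\<Prod>k<length xs. measure (\<tau> (xs ! k)) (A k))"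
    proof (cases "word_prob w xs > 0")
      case True
      have "poly_cyl xs A \<inter> ?X = poly_cyl xs (\<lambda>k. A k \<inter> msupp (\<tau> (xs ! k))) \<inter> ?X"
        by (auto simp: poly_cyl_def Xi_iff) metis
      also have "measure M \<dots> = word_prob w xs * (\<Prod>k<length xs. measure (\<tau> (xs ! k)) (A k \<inter> msupp (\<tau> (xs ! k))))"
        using A Gamma_borel True by (intro M) auto
      also have "(\<Prod>k<length xs. measure (\<tau> (xs ! k)) (A k \<inter> msupp (\<tau> (xs ! k)))) = (\<Prod>k<length xs. measure (\<tau> (xs ! k)) (A k))"
        using A by (intro prod.cong refl measure_tau_Int) auto
      finally show ?thesis .
    next
      case False
      have "\<omega> \<notin> ?X" if "\<omega> \<in> poly_cyl xs A" for \<omega>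
      proof -
        have "map (\<lambda>k. snd (\<omega> k)) [0..<length xs] = xs"
          using that by (auto simp: poly_cyl_def map_upt_eq_iff)
        then show ?thesis using False by (metis Xi_iff)
      qed
      then have "poly_cyl xs A \<inter> ?X = {}" by blast
      moreover have "word_prob w xs = 0" using False word_prob_nonneg[of w xs] by simp
      ultimately show ?thesis by simp
    qed
    then show "emeasure N (poly_cyl xs A) = emeasure (joint w) (poly_cyl xs A)"
      using A by (simp add: N_eq poly_cyl_sets finite_measure.emeasure_eq_measure[OF fin] emeasure_joint_eq)
  qed (simp_all add: N_def sets_joint)
  show "M = restrict_space (joint w) ?X"
  proof (rule measure_eqI)
    show "sets M = sets (restrict_space (joint w) ?X)"
      unfolding setsM by (rule sets_restrict_space_cong[OF sets_joint[symmetric]])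
    fix E assume "E \<in> sets M"
    then have E: "E \<subseteq> ?X" "E \<in> sets ?L"
      using Xi_sets[of w] by (auto simp: setsM sets_restrict_space)
    then have "emeasure M E = emeasure N E" by (simp add: N_eq Int_absorb2)
    also have "\<dots> = emeasure (restrict_space (joint w) ?X) E"
      unfolding \<open>N = joint w\<close> using E(1) by (rule emeasure_restrict_space[OF Xi_in_joint, symmetric])
    finally show "emeasure M E = emeasure (restrict_space (joint w) ?X) E" .
  qed
qed

end

section \<open>Escaping orbits\<close>

lemma poly_comp_snoc: "poly_comp (gs @ [g]) z = app g (poly_comp gs z)"
  by (simp add: poly_comp_def)

lemma near_infty_antimono: "R \<le> S \<Longrightarrow> near_infty S \<subseteq> near_infty R"
  unfolding near_infty_def by (intro Compl_anti_mono image_mono) auto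

text \<open>Integer radii make the limit a countable combination of events, which gives
  measurability of \<open>escaping\<close>.\<close>

lemma tendsto_Infty_iff: "(f \<longlongrightarrow> Infty) F \<longleftrightarrow> (\<forall>m::nat. \<forall>\<^sub>F x in F. f x \<in> near_infty (real m))"
proof
  assume "(f \<longlongrightarrow> Infty) F"
  then show "\<forall>m::nat. \<forall>\<^sub>F x in F. f x \<in> near_infty (real m)"
    using topological_tendstoD[OF _ open_near_infty] near_infty_simps(1) by blast
next
  assume m: "\<forall>m::nat. \<forall>\<^sub>F x in F. f x \<in> near_infty (real m)"
  show "(f \<longlongrightarrow> Infty) F"
  proof (rule tendsto_InftyI)
    fix R
    obtain m :: nat where "R \<le> real m" using real_arch_simple by blast
    then have "near_infty (real m) \<subseteq> near_infty R" by (rule near_infty_antimono)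
    then show "\<forall>\<^sub>F x in F. f x \<in> near_infty R"
      using m eventually_mono by (metis (no_types, lifting) subsetD)
  qed
qed

lemma app_near_infty:
  assumes "expands R g" "R \<le> S" "S \<ge> 0" "z \<in> near_infty S"
  shows "app g z \<in> near_infty (2 * S)"
proof (cases z)
  case (Fin v)
  show ?thesis
  proof (cases "app g (Fin v)")
    fix v' assume "app g (Fin v) = Fin v'"
    moreover have "S < cmod v" using assms(4) Fin by simp
    ultimately have "2 * cmod v \<le> cmod v'" using assms(1,2) unfolding expands_def by auto
    then show ?thesis using \<open>S < cmod v\<close> \<open>app g (Fin v) = Fin v'\<close> Fin by simp
  qed (simp add: Fin)
qed simp

text \<open>Beyond \<open>R\<close> the lower bound on the modulus doubles at every step, and
  \<open>2 ^ k * R\<close> is unbounded because \<open>R \<ge> 1\<close>.\<close>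

lemma escape:
  assumes g: "\<And>n. expands R (g n)" and R: "R \<ge> 1"
    and n: "poly_comp (map g [0..<n]) z \<in> near_infty R"
  shows "(\<lambda>n. poly_comp (map g [0..<n]) z) \<longlonglongrightarrow> Infty"
proof -
  have *: "poly_comp (map g [0..<n + k]) z \<in> near_infty (2 ^ k * R)" for k
  proof (induction k)
    case (Suc k)
    have "1 * R \<le> 2 ^ k * R" using R by (intro mult_right_mono) auto
    then have "app (g (n + k)) (poly_comp (map g [0..<n + k]) z) \<in> near_infty (2 * (2 ^ k * R))"
      using R by (intro app_near_infty[OF g _ _ Suc]) auto
    then show ?case by (simp add: poly_comp_snoc mult.assoc)
  qed (use n in simp)
  show ?thesis
    unfolding tendsto_Infty_iff
  proof
    fix m :: nat
    obtain k where k: "real m < 2 ^ k" using real_arch_pow[of 2 "real m"] by auto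
    show "\<forall>\<^sub>F i in sequentially. poly_comp (map g [0..<i]) z \<in> near_infty (real m)"
    proof (rule eventually_sequentiallyI)
      fix i assume "n + k \<le> i"
      then obtain j where i: "i = n + (k + j)" by (metis add.assoc le_iff_add)
      have "real m \<le> 2 ^ k * 1" using k by simp
      also have "\<dots> \<le> 2 ^ (k + j) * R" using R by (intro mult_mono power_increasing) auto
      finally show "poly_comp (map g [0..<i]) z \<in> near_infty (real m)"
        using *[of "k + j"] near_infty_antimono unfolding i by blast
    qed
  qed
qed

text \<open>The last map is peeled off: joint continuity pulls \<open>V\<close> back to a product
  neighbourhood \<open>A \<times> B\<close>, and \<open>B\<close> becomes the target of the shorter
  composition. A single \<open>e\<close> for all positions lets balls of one radius form the
  cylinder in \<open>K_fill_if_T_inf_eq_0\<close>.\<close>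

lemma poly_comp_open:
  assumes "open V" "poly_comp gs z \<in> V"
  shows "\<exists>e>0. \<forall>hs. length hs = length gs \<longrightarrow> (\<forall>i<length gs. dist (hs ! i) (gs ! i) < e) \<longrightarrow> poly_comp hs z \<in> V"
  using assms
proof (induction gs arbitrary: V rule: rev_induct)
  case Nil
  then show ?case by (auto intro!: exI[of _ 1] simp: poly_comp_def)
next
  case (snoc g gs)
  let ?y = "poly_comp gs z"
  have "open ((\<lambda>x. app (fst x) (snd x)) -` V)"
    using snoc.prems(1) by (rule open_vimage[OF _ app_continuous_pair])
  moreover have "(g, ?y) \<in> (\<lambda>x. app (fst x) (snd x)) -` V"
    using snoc.prems(2) by (simp add: poly_comp_snoc)
  ultimately obtain A B where AB: "open A" "open B" "(g, ?y) \<in> A \<times> B" "A \<times> B \<subseteq> (\<lambda>x. app (fst x) (snd x)) -` V"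
    by (rule open_prod_elim)
  from AB(1,3) obtain d where d: "d > 0" "\<And>h. dist h g < d \<Longrightarrow> h \<in> A" unfolding open_dist by auto
  from snoc.IH[OF AB(2)] AB(3) obtain e where e: "e > 0"
    "\<And>hs. length hs = length gs \<Longrightarrow> (\<forall>i<length gs. dist (hs ! i) (gs ! i) < e) \<Longrightarrow> poly_comp hs z \<in> B" by auto
  show ?case
  proof (intro exI[of _ "min d e"] conjI allI impI)
    fix hs assume l: "length hs = length (gs @ [g])" and c: "\<forall>i<length (gs @ [g]). dist (hs ! i) ((gs @ [g]) ! i) < min d e"
    define hs' h where "hs' = butlast hs" and "h = last hs"
    have hs: "hs = hs' @ [h]" and l': "length hs' = length gs"
      using l by (auto simp: hs'_def h_def intro!: append_butlast_last_id[symmetric])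
    have "dist (hs' ! i) (gs ! i) < e" if "i < length gs" for i
      using c[rule_format, of i] that l' by (simp add: hs nth_append)
    then have "poly_comp hs' z \<in> B" using e(2) l' by blast
    moreover have "h \<in> A" using c[rule_format, of "length gs"] l' by (intro d(2)) (simp add: hs nth_append)
    ultimately show "poly_comp hs z \<in> V" using AB(4) by (auto simp: hs poly_comp_snoc)
  qed (use d e in auto)
qed

lemma orbit_measurable:
  "(\<lambda>\<omega>. poly_comp (map (\<lambda>k. fst (\<omega> k)) [0..<n]) z) \<in> measurable (PiM UNIV (\<lambda>_::nat. letters)) borel"
proof (induction n)
  case (Suc n)
  have "(\<lambda>\<omega>. fst (\<omega> n)) \<in> measurable (PiM UNIV (\<lambda>_::nat. letters)) borel"
    by (rule measurable_compose[OF measurable_component_singleton[of n] measurable_fst]) simp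
  from borel_measurable_continuous_Pair[OF this Suc app_continuous_pair]
  show ?case by (simp add: poly_comp_snoc)
qed (simp add: poly_comp_def)

section \<open>Escaping probability and filled-in sets\<close>

context finite_poly_rscc
begin

definition escaping :: "rsphere \<Rightarrow> (nat \<Rightarrow> poly_map \<times> 'x) set" where
  "escaping z = {\<omega>. (\<lambda>n. poly_comp (map (\<lambda>k. fst (\<omega> k)) [0..<n]) z) \<longlonglongrightarrow> Infty}"

lemma escaping_sets: "escaping z \<in> sets (PiM UNIV (\<lambda>_::nat. letters))" (is "_ \<in> sets ?L")
proof -
  have "{\<omega> \<in> space ?L. poly_comp (map (\<lambda>k. fst (\<omega> k)) [0..<n]) z \<in> near_infty (real m)} \<in> sets ?L" for n m
    using measurable_sets[OF orbit_measurable[of n z] borel_open[OF open_near_infty[of "real m"]]]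
    by (simp add: vimage_def)
  then have "{\<omega> \<in> space ?L. \<forall>m::nat. \<exists>N. \<forall>n\<in>{N..}. poly_comp (map (\<lambda>k. fst (\<omega> k)) [0..<n]) z \<in> near_infty (real m)} \<in> sets ?L"
    by (intro sets.sets_Collect_countable_All sets.sets_Collect_countable_Ex sets.sets_Collect_countable_Ball) auto
  also have "{\<omega> \<in> space ?L. \<forall>m::nat. \<exists>N. \<forall>n\<in>{N..}. poly_comp (map (\<lambda>k. fst (\<omega> k)) [0..<n]) z \<in> near_infty (real m)} = escaping z"
    by (simp add: escaping_def tendsto_Infty_iff eventually_sequentially atLeast_def)
  finally show ?thesis .
qed

lemma T_inf_eq: "T_inf u P \<tau> w z = measure (joint w) (escaping z \<inter> Xi u P \<tau> w)"
proof -
  have "{\<omega> \<in> Xi u P \<tau> w. (\<lambda>n. poly_comp (map (\<lambda>k. fst (\<omega> k)) [0..<n]) z) \<longlonglongrightarrow> Infty} = escaping z \<inter> Xi u P \<tau> w"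
    by (auto simp: escaping_def)
  then show ?thesis
    unfolding T_inf_def tau_path_eq by (simp add: measure_restrict_space[OF Xi_in_joint])
qed

lemma T_inf_nonneg: "T_inf u P \<tau> w z \<ge> 0"
  by (simp add: T_inf_eq)

lemma T_inf_le_1: "T_inf u P \<tau> w z \<le> 1"
  unfolding T_inf_eq by (rule prob_space.prob_le_1[OF prob_joint])

text \<open>Every nonempty prefix of a path in \<open>Xi\<close> yields a member of
  \<open>Hset\<close>, so escape is excluded for each single path and not merely almost
  surely.\<close>

lemma T_inf_eq_0_if_K_fill:
  assumes "z \<in> K_fill u P \<tau> w"
  shows "T_inf u P \<tau> w z = 0"
proof -
  from assms obtain S where S: "bounded S" "(\<lambda>g. g z) ` Hset u P \<tau> w \<subseteq> Fin ` S"
    by (auto simp: K_fill_def bounded_in_plane_def)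
  then obtain R where R: "\<And>y. y \<in> S \<Longrightarrow> cmod y \<le> R" unfolding bounded_iff by blast
  have "\<omega> \<notin> escaping z" if \<omega>: "\<omega> \<in> Xi u P \<tau> w" for \<omega>
  proof
    assume "\<omega> \<in> escaping z"
    then have "\<forall>\<^sub>F n in sequentially. poly_comp (map (\<lambda>k. fst (\<omega> k)) [0..<n]) z \<in> near_infty R"
      unfolding escaping_def by (intro topological_tendstoD[OF _ open_near_infty]) auto
    \<comment> \<open>Time 0 has to be avoided, since \<open>Hset\<close> contains only compositions
      of at least one map.\<close>
    then have "\<forall>\<^sub>F n in sequentially. poly_comp (map (\<lambda>k. fst (\<omega> k)) [0..<n]) z \<in> near_infty R \<and> n \<ge> 1"
      using eventually_ge_at_top by (rule eventually_conj)
    then obtain n where n: "poly_comp (map (\<lambda>k. fst (\<omega> k)) [0..<n]) z \<in> near_infty R" "n \<ge> 1"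
      using eventually_happens'[OF sequentially_bot] by blast
    have "poly_comp (map (\<lambda>k. fst (\<omega> k)) [0..<n]) \<in> Hset u P \<tau> w"
      unfolding Hset_def using \<omega> n(2)
      by (intro CollectI exI[of _ "map (\<lambda>k. fst (\<omega> k)) [0..<n]"] exI[of _ n] exI[of _ "map (\<lambda>k. snd (\<omega> k)) [0..<n]"])
         (auto simp: adm_words_iff Xi_iff)
    then have "poly_comp (map (\<lambda>k. fst (\<omega> k)) [0..<n]) z \<in> Fin ` S" using S(2) by blast
    with n(1) R show False by force
  qed
  then have "escaping z \<inter> Xi u P \<tau> w = {}" by blast
  then show ?thesis by (simp add: T_inf_eq)
qed

text \<open>The disc of radius \<open>R\<close> itself witnesses boundedness: a single admissible
  image outside it already forces a positive escaping probability.\<close>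

lemma K_fill_if_T_inf_eq_0:
  assumes R: "R \<ge> 1" "\<And>x g. g \<in> msupp (\<tau> x) \<Longrightarrow> expands R g"
    and T: "T_inf u P \<tau> w z = 0"
  shows "z \<in> K_fill u P \<tau> w"
proof -
  have "g z \<in> Fin ` cball 0 R" if "g \<in> Hset u P \<tau> w" for g
  proof (rule ccontr)
    assume "g z \<notin> Fin ` cball 0 R"
    then have esc: "g z \<in> near_infty R" by (simp add: near_infty_def)
    from that obtain gs n xs where gs: "g = poly_comp gs" "length gs = n" "length xs = n" "word_prob w xs > 0"
      "\<And>j. j < n \<Longrightarrow> gs ! j \<in> msupp (\<tau> (xs ! j))"
      by (auto simp: Hset_def adm_words_iff)
    from poly_comp_open[OF open_near_infty esc[unfolded gs(1)]] obtain e where e: "e > 0"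
      "\<And>hs. length hs = n \<Longrightarrow> (\<And>i. i < n \<Longrightarrow> dist (hs ! i) (gs ! i) < e) \<Longrightarrow> poly_comp hs z \<in> near_infty R"
      using gs(2) by auto
    let ?A = "\<lambda>k. ball (gs ! k) e"
    \<comment> \<open>Intersecting with \<open>Xi\<close> makes all later maps lie in the supports
      and hence expand, and by \<open>measure_joint_Int_Xi\<close> it costs no mass.\<close>
    have sub: "poly_cyl xs ?A \<inter> Xi u P \<tau> w \<subseteq> escaping z \<inter> Xi u P \<tau> w"
    proof safe
      fix \<omega> assume \<omega>: "\<omega> \<in> poly_cyl xs ?A" "\<omega> \<in> Xi u P \<tau> w"
      have "poly_comp (map (\<lambda>k. fst (\<omega> k)) [0..<n]) z \<in> near_infty R"
        using \<omega>(1) gs(3) by (intro e(2)) (auto simp: poly_cyl_def dist_commute)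
      then show "\<omega> \<in> escaping z"
        unfolding escaping_def using \<omega>(2) R by (auto simp: Xi_iff intro!: escape[where R = R])
    qed
    have "measure (\<tau> (xs ! k)) (?A k) > 0" if "k < n" for k
    proof -
      have "emeasure (\<tau> (xs ! k)) (?A k) > 0"
        using gs(5)[OF that] e(1) by (auto simp: msupp_def)
      then show ?thesis
        using finite_measure.emeasure_eq_measure[OF prob_space.finite_measure[OF prob_tau]] by simp
    qed
    then have "0 < word_prob w xs * (\<Prod>k<length xs. measure (\<tau> (xs ! k)) (?A k))"
      using gs by (intro mult_pos_pos prod_pos) auto
    also have "\<dots> = measure (joint w) (poly_cyl xs ?A \<inter> Xi u P \<tau> w)"
      by (simp add: measure_joint_Int_Xi poly_cyl_sets measure_joint)
    also have "\<dots> \<le> T_inf u P \<tau> w z"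
      unfolding T_inf_eq using escaping_sets Xi_sets
      by (intro finite_measure.finite_measure_mono[OF prob_space.finite_measure[OF prob_joint] sub])
         (auto simp: sets_joint)
    finally show False using T by simp
  qed
  then show ?thesis
    unfolding K_fill_def bounded_in_plane_def by (auto intro!: exI[of _ "cball 0 R"])
qed

end

section \<open>Averaging over the stationary distribution\<close>

theorem mainTheorem4:
  fixes u :: "'w::metric_space \<Rightarrow> 'x::{finite, discrete_topology} \<Rightarrow> 'w"
    and P :: "'w \<Rightarrow> 'x measure"
    and \<tau> :: "'x \<Rightarrow> poly_map measure"
    and \<pi> :: "'w measure"
    and B1 B2 :: "'w set"
  assumes rscc: "RSCC (borel :: 'w measure) (count_space (UNIV :: 'x set)) u P"
    and compact_W: "compact (UNIV :: 'w set)"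
    and cont_P: "\<And>x. continuous_on UNIV (\<lambda>v. measure (P v) {x})"
    and cont_Q: "\<And>f :: 'w \<Rightarrow> real. continuous_on UNIV f \<Longrightarrow> continuous_on UNIV (trans_op u P f)"
    and tau_borel: "\<And>x. sets (\<tau> x) = sets borel"
    and tau_prob: "\<And>x. prob_space (\<tau> x)"
    and compact_Gamma: "\<And>x. compact (msupp (\<tau> x))"
    and Gamma_plus: "\<And>x. msupp (\<tau> x) \<subseteq> Poly_plus"
    and stat: "\<pi> \<in> Stat u P"
    and supp_pi: "msupp \<pi> = UNIV"
    and cont_T: "\<And>z. continuous_on UNIV (\<lambda>w. T_inf u P \<tau> w z)"
    and B1: "B1 \<in> sets borel" "measure \<pi> B1 > 0"
    and B2: "B2 \<in> sets borel" "measure \<pi> B2 > 0"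
    and K1: "K_ess u P \<tau> \<pi> B1 \<noteq> {}"
    and K2: "K_ess u P \<tau> \<pi> B2 \<noteq> {}"
    and disj: "K_ess u P \<tau> \<pi> B1 \<inter> K_ess u P \<tau> \<pi> B2 = {}"
  shows "(\<forall>z. T_inf_avg u P \<tau> \<pi> z > 0) \<and> (\<exists>z0. T_inf_avg u P \<tau> \<pi> z0 < 1)"
proof -
  have "P v \<in> space (prob_algebra (count_space UNIV))" for v
    using rscc measurable_space[of P borel "prob_algebra (count_space UNIV)" v] by (auto simp: RSCC_def)
  then have "sets (P v) = UNIV" "prob_space (P v)" for v by (simp_all add: space_prob_algebra)
  then interpret finite_poly_rscc u P \<tau>
    using tau_borel tau_prob by (rule finite_poly_rscc.intro)
  have pi: "sets \<pi> = sets borel" "prob_space \<pi>" using stat by (auto simp: Stat_def)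
  interpret pi: prob_space \<pi> by (rule pi(2))
  have sp: "space \<pi> = UNIV" using sets_eq_imp_space_eq[OF pi(1)] by simp
  have T_meas: "(\<lambda>w. T_inf u P \<tau> w z) \<in> borel_measurable \<pi>" for z
    using borel_measurable_continuous_onI[OF cont_T, of z] measurable_cong_sets[OF pi(1) refl] by blast
  have T_int: "integrable \<pi> (\<lambda>w. T_inf u P \<tau> w z)" for z
    using T_inf_nonneg T_inf_le_1 by (intro pi.integrable_const_bound[of _ 1] T_meas) auto
  have "\<exists>R. R \<ge> 1 \<and> (\<forall>g\<in>msupp (\<tau> x). expands R g)" for x
    using compact_expands[OF compact_Gamma Gamma_plus, of x] by metis
  then obtain r where r: "\<And>x. r x \<ge> (1::real)" "\<And>x g. g \<in> msupp (\<tau> x) \<Longrightarrow> expands (r x) g" by metis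
  \<comment> \<open>The maximum exists because there are finitely many indices;
    \<open>expands_mono\<close> then gives one radius for all generators.\<close>
  define R where "R = Max (range r)"
  have rR: "r x \<le> R" for x by (simp add: R_def)
  have R: "R \<ge> 1" "\<And>x g. g \<in> msupp (\<tau> x) \<Longrightarrow> expands R g"
    using r rR expands_mono order_trans by blast+
  have pos: "T_inf_avg u P \<tau> \<pi> z > 0" for z
  proof (rule ccontr)
    assume "\<not> T_inf_avg u P \<tau> \<pi> z > 0"
    moreover have "T_inf_avg u P \<tau> \<pi> z \<ge> 0"
      unfolding T_inf_avg_def by (simp add: T_inf_nonneg integral_nonneg)
    ultimately have "(\<integral>w. T_inf u P \<tau> w z \<partial>\<pi>) = 0" by (simp add: T_inf_avg_def)
    then have ae: "AE w in \<pi>. T_inf u P \<tau> w z = 0"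
      using integral_nonneg_eq_0_iff_AE[OF T_int] T_inf_nonneg by simp
    have "T_inf u P \<tau> w z = 0" for w
    proof (rule ccontr)
      assume "T_inf u P \<tau> w z \<noteq> 0"
      define U where "U = (\<lambda>w. T_inf u P \<tau> w z) -` (- {0})"
      have "open U" unfolding U_def by (rule open_vimage[OF _ cont_T]) auto
      moreover have "w \<in> U" using \<open>T_inf u P \<tau> w z \<noteq> 0\<close> by (simp add: U_def)
      ultimately have "emeasure \<pi> U > 0" using supp_pi by (auto simp: msupp_def)
      moreover have "emeasure \<pi> U = emeasure \<pi> {}"
        using ae \<open>open U\<close> by (intro emeasure_eq_AE) (auto simp: U_def pi(1))
      ultimately show False by simp
    qed
    then have "z \<in> K_fill u P \<tau> w" for w by (intro K_fill_if_T_inf_eq_0[OF R])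
    \<comment> \<open>The sets measured in \<open>K_ess\<close> are now all of \<open>B1\<close> and
      all of \<open>B2\<close>.\<close>
    then have "z \<in> K_ess u P \<tau> \<pi> B1 \<inter> K_ess u P \<tau> \<pi> B2" by (simp add: K_ess_def)
    with disj show False by blast
  qed
  obtain z0 where "z0 \<in> K_ess u P \<tau> \<pi> B1" using K1 by blast
  define S where "S = {w \<in> B1. z0 \<in> K_fill u P \<tau> w}"
  have S: "measure \<pi> S > 0"
    using \<open>z0 \<in> K_ess u P \<tau> \<pi> B1\<close> B1(2) by (simp add: S_def K_ess_def)
  \<comment> \<open>\<open>measure\<close> has the default value 0 on non-measurable sets, so
    positivity yields measurability of \<open>S\<close> without any regularity of
    \<open>K_fill\<close> in \<open>w\<close>.\<close>
  then have S_sets: "S \<in> sets \<pi>" using measure_notin_sets by force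
  then have compl_S: "- S \<in> sets \<pi>" using sets.compl_sets[of S \<pi>] by (simp add: sp Compl_eq_Diff_UNIV)
  \<comment> \<open>The escaping probability vanishes on \<open>S\<close> and is at most 1
    elsewhere, so the indicator of the complement dominates it.\<close>
  have "T_inf_avg u P \<tau> \<pi> z0 \<le> (\<integral>w. indicator (- S) w \<partial>\<pi>)"
    unfolding T_inf_avg_def
  proof (rule integral_mono[OF T_int])
    show "integrable \<pi> (indicator (- S) :: 'w \<Rightarrow> real)"
      using compl_S by (intro integrable_real_indicator) (auto simp: less_top[symmetric])
    fix w show "T_inf u P \<tau> w z0 \<le> indicator (- S) w"
      using T_inf_le_1 T_inf_eq_0_if_K_fill[of z0 w] by (auto simp: S_def indicator_def)
  qed
  also have "\<dots> = 1 - measure \<pi> S"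
    using pi.prob_compl[OF S_sets] sp compl_S by (simp add: Compl_eq_Diff_UNIV)
  also have "\<dots> < 1" using S by simp
  finally have "T_inf_avg u P \<tau> \<pi> z0 < 1" .
  with pos show ?thesis by blast
qed

end
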